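(* Let $k\ge 1$ and suppose $H_k=2^{2k+1}-2^{k+1}+1$ is prime. Let $m$ be an integer with $m\not\equiv 0\pmod{H_k}$ that is a fourth power modulo $H_k$, and let $E(H_k)$ be the group of $\mathbb{F}_{H_k}$-rational points of the elliptic curve $E:y^2=x^3-mx$. Then \[E(H_k)\cong \mathbb{Z}/2^{k}\mathbb{Z}\oplus \mathbb{Z}/2^{k+1}\mathbb{Z}.\] *)

theory Defs
  imports "HOL-Number_Theory.Residues" "HOL-Algebra.Elementary_Groups"
begin

definition H :: "nat \<Rightarrow> int" where
  "H k = 2 ^ (2 * k + 1) - 2 ^ (k + 1) + 1"

datatype 'a ec_point = Infinity | Affine 'a 'a

(* The chord-and-tangent law below is a group law when R is a field of characteristic
   different from 2 and 3 and the cubic x^3 + a x + b has no repeated root. *)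

context
  fixes R :: "('a, 'b) ring_scheme" (structure)
begin

definition ec_points :: "'a \<Rightarrow> 'a \<Rightarrow> 'a ec_point set" where
  "ec_points a b = insert Infinity
     {Affine x y | x y. x \<in> carrier R \<and> y \<in> carrier R \<and>
        y [^] (2::nat) = x [^] (3::nat) \<oplus> a \<otimes> x \<oplus> b}"

(* Points with equal abscissa are equal or opposite, so once the case Q = -P (which includes
   the doubling of a point of order 2) is excluded, x1 = x2 means that the line is tangent. *)
fun ec_add :: "'a \<Rightarrow> 'a ec_point \<Rightarrow> 'a ec_point \<Rightarrow> 'a ec_point" where
  "ec_add a Infinity Q = Q"
| "ec_add a P Infinity = P"
| "ec_add a (Affine x1 y1) (Affine x2 y2) =
    (if x1 = x2 \<and> y1 = \<ominus> y2 then Infinity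
     else
       let l = (if x1 = x2
                then ([(3::nat)] \<cdot> (x1 [^] (2::nat)) \<oplus> a) \<otimes> inv ([(2::nat)] \<cdot> y1)
                else (y2 \<ominus> y1) \<otimes> inv (x2 \<ominus> x1));
           x3 = l [^] (2::nat) \<ominus> x1 \<ominus> x2
       in Affine x3 (l \<otimes> (x1 \<ominus> x3) \<ominus> y1))"

definition ec_group :: "'a \<Rightarrow> 'a \<Rightarrow> 'a ec_point monoid" where
  "ec_group a b = \<lparr>carrier = ec_points a b, monoid.mult = ec_add a, one = Infinity\<rparr>"

end

end

theory Submission
  imports Defs "HOL-Number_Theory.Euler_Criterion"
begin

text \<open>
  Put \<open>t = 2 ^ k\<close>, so that \<open>H k = t\<^sup>2 + (t - 1)\<^sup>2\<close>. A square root \<open>I\<close> of \<open>-1\<close> modulo \<open>p = H k\<close> gives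
  the endomorphism \<open>(x, y) \<mapsto> (- x, I y)\<close> with square \<open>-1\<close>, so the group of points is a module over
  the Gaussian integers, and \<open>1 + i\<close> has the kernel \<open>{\<infinity>, (0, 0)}\<close> of order 2. A finite module of
  this kind of order \<open>2 ^ (2 k + 1)\<close> is uniserial, hence isomorphic to the Gaussian integers modulo
  \<open>(1 + i) ^ (2 k + 1)\<close>, which is \<open>\<int>/2^k \<oplus> \<int>/2^(k+1)\<close>. The order is \<open>p + 1 + 2 A\<close> for some
  \<open>A\<^sup>2 + B\<^sup>2 = p\<close> by Jacobsthal's identity; as the representation of \<open>p\<close> as a sum of two squares is
  unique, \<open>A\<close> is one of \<open>\<plusminus> t\<close>, \<open>\<plusminus> (t - 1)\<close>, and only \<open>A = t - 1\<close> makes the order divisible by 8, as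
  the point \<open>(c\<^sup>2 I, c\<^sup>3 (1 - I))\<close>, where \<open>m = c ^ 4\<close>, requires.

  Associativity of the addition needs no large computation. If \<open>l1, l2, l3, l4\<close> are the slopes of the
  lines for \<open>P + Q\<close>, \<open>(P + Q) + T\<close>, \<open>Q + T\<close> and \<open>P + (Q + T)\<close>, then
  \<open>(l1 + l2) (l3 - l1) = x(T) - x(P)\<close>. By symmetry \<open>l1 + l2 = l3 + l4\<close>, and both sums have the same
  coordinates.
\<close>

section \<open>Quadratic characters and Jacobsthal sums\<close>

locale odd_prime =
  fixes p :: int
  assumes prime: "prime p" and odd: "p \<noteq> 2"
begin

lemma dvd_mult_cancel: "p dvd u * v \<Longrightarrow> \<not> p dvd u \<Longrightarrow> p dvd v"
  using prime by (simp add: prime_dvd_mult_iff)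

lemma p_gt_2: "p > 2"
  using prime odd prime_ge_2_int[of p] by linarith

lemma two_not_dvd: "\<not> p dvd 2"
  using p_gt_2 by (simp add: zdvd_not_zless)

lemma double_dvd: "p dvd 2 * u \<Longrightarrow> p dvd u"
  using dvd_mult_cancel two_not_dvd by blast

lemma eq_iff_dvd:
  "0 \<le> x \<Longrightarrow> x < p \<Longrightarrow> 0 \<le> y \<Longrightarrow> y < p \<Longrightarrow> x = y \<longleftrightarrow> p dvd x - y"
  by (metis mod_eq_dvd_iff mod_pos_pos_trivial)

lemma mod_dvd [simp]: "p dvd x - x mod p" "p dvd x mod p - x"
  by (simp_all add: dvd_minus_mod mod_0_imp_dvd mod_diff_left_eq)

section \<open>The quadratic character modulo \<open>p\<close>\<close>

definition chi :: "int \<Rightarrow> int" where "chi a = Legendre a p"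

lemma chi_cong: "p dvd a - b \<Longrightarrow> chi a = chi b"
proof -
  assume "p dvd a - b"
  then have "[a = b] (mod p)" by (simp add: cong_iff_dvd_diff)
  then have "[a = c] (mod p) \<longleftrightarrow> [b = c] (mod p)" "[c = a] (mod p) \<longleftrightarrow> [c = b] (mod p)" for c
    by (auto simp: cong_def)
  then show ?thesis by (simp add: chi_def Legendre_def QuadRes_def)
qed

lemma chi_values: "chi a = 0 \<or> chi a = 1 \<or> chi a = - 1"
  by (simp add: chi_def Legendre_def)

lemma chi_eq_0_iff: "chi a = 0 \<longleftrightarrow> p dvd a"
  by (simp add: chi_def Legendre_def cong_0_iff)

lemma chi_square_values: "(chi a)\<^sup>2 = (if p dvd a then 0 else 1)"
  using chi_values[of a] chi_eq_0_iff[of a] by auto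

lemma chi_eq_1_iff: "chi a = 1 \<longleftrightarrow> \<not> p dvd a \<and> (\<exists>y. p dvd y\<^sup>2 - a)"
  by (simp add: chi_def Legendre_def cong_0_iff QuadRes_def cong_iff_dvd_diff)

text \<open>Euler's criterion makes both sides congruent modulo \<open>p\<close>. They differ by at
  most 2, and \<open>p > 2\<close>, so they are equal.\<close>

lemma chi_mult: "chi (a * b) = chi a * chi b"
proof -
  have p: "prime (nat p)" using prime prime_int_nat_transfer by blast
  have p2: "2 < nat p" "int (nat p) = p" using p_gt_2 by simp_all
  have e: "p dvd chi c - c ^ ((nat p - 1) div 2)" for c
    using euler_criterion[OF p p2(1), of c] p2(2) by (simp add: chi_def cong_iff_dvd_diff)
  have "p dvd z - x * y" if "p dvd x - u" "p dvd y - v" "p dvd z - u * v" for x y z u v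
    using that by Groebner_Basis.algebra
  then have "p dvd chi (a * b) - chi a * chi b"
    using e[of a] e[of b] e[of "a * b"] unfolding power_mult_distrib by blast
  moreover have "\<bar>chi (a * b) - chi a * chi b\<bar> \<le> 2"
    using chi_values[of a] chi_values[of b] chi_values[of "a * b"] by auto
  ultimately show ?thesis using p_gt_2 dvd_imp_le_int[of "chi (a * b) - chi a * chi b" p] by auto
qed

lemma chi_square: "\<not> p dvd a \<Longrightarrow> chi (a\<^sup>2) = 1"
  using chi_square_values[of a] by (simp add: power2_eq_square chi_mult)

section \<open>Complete character sums over the residues\<close>

lemma sum_reindex_affine:
  assumes u: "\<not> p dvd u" and f: "\<And>x y. p dvd x - y \<Longrightarrow> f x = f y"
  shows "(\<Sum>x\<in>{0..<p}. f (u * x + v)) = (\<Sum>x\<in>{0..<p}. f x)"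
proof -
  let ?g = "\<lambda>x. (u * x + v) mod p"
  have inj: "inj_on ?g {0..<p}"
  proof (rule inj_onI)
    fix x y assume xy: "x \<in> {0..<p}" "y \<in> {0..<p}" "?g x = ?g y"
    then have "p dvd (u * x + v) - (u * y + v)" by (simp only: mod_eq_dvd_iff)
    then have "p dvd u * (x - y)" by (simp add: algebra_simps)
    then have "p dvd x - y" using u dvd_mult_cancel by blast
    then show "x = y" using xy(1,2) eq_iff_dvd by simp
  qed
  moreover have "?g ` {0..<p} \<subseteq> {0..<p}" using p_gt_2 by auto
  ultimately have "bij_betw ?g {0..<p} {0..<p}"
    by (simp add: bij_betw_def endo_inj_surj)
  then have "(\<Sum>x\<in>{0..<p}. f (?g x)) = (\<Sum>x\<in>{0..<p}. f x)" by (rule sum.reindex_bij_betw)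
  moreover have "f (?g x) = f (u * x + v)" for x by (rule f) simp
  ultimately show ?thesis by simp
qed

text \<open>Squaring identifies 1 and \<open>p - 1\<close>, so it is not injective on the finite set
  of residues and therefore misses one of them.\<close>

lemma ex_nonresidue: obtains r where "chi r = - 1"
proof -
  let ?g = "\<lambda>x. x\<^sup>2 mod p"
  have "?g 1 = ?g (p - 1)" by (simp add: mod_eq_dvd_iff power2_eq_square algebra_simps)
  moreover have "1 \<noteq> p - 1" "1 \<in> {0..<p}" "p - 1 \<in> {0..<p}" using p_gt_2 by auto
  ultimately have "\<not> inj_on ?g {0..<p}" unfolding inj_on_def by blast
  then have "card (?g ` {0..<p}) \<noteq> card {0..<p}"
    using eq_card_imp_inj_on by blast
  then have "?g ` {0..<p} \<noteq> {0..<p}" by metis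
  moreover have "?g ` {0..<p} \<subseteq> {0..<p}" using p_gt_2 by auto
  ultimately obtain r where r: "0 \<le> r" "r < p" "r \<notin> ?g ` {0..<p}" by fastforce
  have no_root: "\<not> p dvd y\<^sup>2 - r" for y
  proof
    assume "p dvd y\<^sup>2 - r"
    then have "y\<^sup>2 mod p = r mod p" by (simp only: mod_eq_dvd_iff)
    then have "r = ?g (y mod p)" using r by (simp add: power_mod)
    moreover have "y mod p \<in> {0..<p}" using p_gt_2 by simp
    ultimately show False using r(3) by blast
  qed
  then have "chi r \<noteq> 1" by (simp add: chi_eq_1_iff)
  moreover have "chi r \<noteq> 0" using no_root[of 0] by (simp add: chi_eq_0_iff)
  ultimately show ?thesis using that chi_values by blast
qed

text \<open>Multiplying the variable by a nonresidue permutes the residues and changes the sign of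
  every term.\<close>

lemma sum_chi: "(\<Sum>x\<in>{0..<p}. chi x) = 0"
proof -
  obtain r where r: "chi r = - 1" by (rule ex_nonresidue)
  then have nr: "\<not> p dvd r" using chi_eq_0_iff[of r] by simp
  have "(\<Sum>x\<in>{0..<p}. chi x) = (\<Sum>x\<in>{0..<p}. chi (r * x + 0))"
    by (rule sum_reindex_affine[OF nr, symmetric]) (rule chi_cong)
  also have "\<dots> = - (\<Sum>x\<in>{0..<p}. chi x)" by (simp add: chi_mult r sum_negf)
  finally show ?thesis by simp
qed

lemma residues_remove_0: "{0..<p} = insert 0 {1..<p}"
  using p_gt_2 by auto

lemma not_dvd_pos: "x \<in> {1..<p} \<Longrightarrow> \<not> p dvd x"
  by (simp add: zdvd_not_zless)

lemma sum_chi_square: "(\<Sum>x\<in>{0..<p}. (chi x)\<^sup>2) = p - 1"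
proof -
  have "(\<Sum>x\<in>{1..<p}. (chi x)\<^sup>2) = (\<Sum>x\<in>{1..<p}. 1)"
    using not_dvd_pos by (intro sum.cong) (auto simp: chi_square_values)
  then show ?thesis using p_gt_2 by (simp add: residues_remove_0 chi_square_values)
qed

text \<open>
  The sum does not depend on \<open>d\<close>, so it is enough to sum it over all \<open>d\<close>.
\<close>

lemma sum_chi_shift:
  assumes d: "\<not> p dvd d" shows "(\<Sum>n\<in>{0..<p}. chi n * chi (n + d)) = - 1"
proof -
  let ?T = "\<lambda>d. \<Sum>n\<in>{0..<p}. chi n * chi (n + d)"
  have T: "?T d = ?T 1" if d: "\<not> p dvd d" for d
  proof -
    have "?T d = (\<Sum>n\<in>{0..<p}. chi (d * n + 0) * chi (d * n + 0 + d))"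
    proof (rule sum_reindex_affine[OF d, symmetric])
      fix x y assume "p dvd x - y"
      then show "chi x * chi (x + d) = chi y * chi (y + d)"
        using chi_cong[of x y] chi_cong[of "x + d" "y + d"] by simp
    qed
    also have "\<dots> = (\<Sum>n\<in>{0..<p}. (chi d)\<^sup>2 * (chi n * chi (n + 1)))"
    proof (rule sum.cong)
      fix n
      have "chi (d * n + 0 + d) = chi d * chi (n + 1)"
        using chi_mult[of d "n + 1"] by (simp add: algebra_simps)
      then show "chi (d * n + 0) * chi (d * n + 0 + d) = (chi d)\<^sup>2 * (chi n * chi (n + 1))"
        by (simp add: chi_mult power2_eq_square)
    qed simp
    also have "\<dots> = ?T 1" using d by (simp add: chi_square_values flip: sum_distrib_left)
    finally show ?thesis .
  qed
  \<comment> \<open>After the exchange of the two sums, the inner sum over \<open>d\<close> runs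
    through all residues and vanishes.\<close>
  have "(\<Sum>d\<in>{0..<p}. ?T d) = (\<Sum>n\<in>{0..<p}. chi n * (\<Sum>d\<in>{0..<p}. chi (1 * d + n)))"
    unfolding sum_distrib_left by (subst sum.swap) (simp add: add.commute)
  also have "\<dots> = (\<Sum>n\<in>{0..<p}. chi n * (\<Sum>d\<in>{0..<p}. chi d))"
    using p_gt_2 chi_cong by (intro sum.cong refl arg_cong2[where f = "(*)"] sum_reindex_affine) auto
  finally have "(\<Sum>d\<in>{0..<p}. ?T d) = 0" by (simp add: sum_chi)
  moreover have "(\<Sum>d\<in>{0..<p}. ?T d) = ?T 0 + (\<Sum>d\<in>{1..<p}. ?T d)"
    unfolding residues_remove_0 by (rule sum.insert) auto
  moreover have "?T 0 = p - 1" using sum_chi_square by (simp add: power2_eq_square)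
  moreover have "(\<Sum>d\<in>{1..<p}. ?T d) = (\<Sum>d\<in>{1..<p}. ?T 1)"
    by (intro sum.cong refl T not_dvd_pos)
  ultimately have "(p - 1) * (1 + ?T 1) = 0" using p_gt_2 by (simp add: algebra_simps)
  then have "?T 1 = - 1" using p_gt_2 by simp
  with T[OF d] show ?thesis by simp
qed

text \<open>Replacing \<open>n\<close> by \<open>u - n\<close> gives a sum with shift
  \<open>v - u\<close>. If \<open>p\<close> divides the shift, each term is a squared character
  value.\<close>

lemma sum_chi_product:
  "(\<Sum>n\<in>{0..<p}. chi (u - n) * chi (v - n)) = (if p dvd u - v then p else 0) - 1"
proof -
  let ?F = "\<lambda>n. chi n * chi (n + (v - u))"
  have "(\<Sum>n\<in>{0..<p}. chi (u - n) * chi (v - n)) = (\<Sum>n\<in>{0..<p}. ?F ((- 1) * n + u))"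
    by (simp add: algebra_simps)
  also have "\<dots> = (\<Sum>n\<in>{0..<p}. ?F n)"
  proof (rule sum_reindex_affine)
    show "\<not> p dvd - 1" using p_gt_2 by simp
    fix x y assume "p dvd x - y"
    then show "?F x = ?F y" using chi_cong[of x y] chi_cong[of "x + (v - u)" "y + (v - u)"] by simp
  qed
  also have "\<dots> = (if p dvd u - v then p else 0) - 1"
  proof (cases "p dvd u - v")
    case True
    then have "chi (n + (v - u)) = chi n" for n by (intro chi_cong) (simp add: dvd_diff_commute)
    with True show ?thesis using sum_chi_square by (simp add: power2_eq_square)
  next
    case False
    then have "\<not> p dvd v - u" by (simp add: dvd_diff_commute)
    with False show ?thesis by (simp add: sum_chi_shift)
  qed
  finally show ?thesis .
qed

text \<open>This is the link between character sums and counting: it serves both for the points of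
  the curve and for the pairs with equal squares in \<open>sum_S_square\<close>.\<close>

lemma card_square_roots: "int (card {y \<in> {0..<p}. p dvd y\<^sup>2 - c}) = 1 + chi c"
proof -
  have neg: "p dvd y\<^sup>2 - c \<longleftrightarrow> p dvd y - z \<or> p dvd y + z" if "p dvd z\<^sup>2 - c" for y z
  proof -
    have "y\<^sup>2 - c = (y\<^sup>2 - z\<^sup>2) + (z\<^sup>2 - c)" by simp
    then have "p dvd y\<^sup>2 - c \<longleftrightarrow> p dvd y\<^sup>2 - z\<^sup>2" by (simp only: dvd_add_left_iff[OF that])
    also have "y\<^sup>2 - z\<^sup>2 = (y - z) * (y + z)" by (simp add: power2_eq_square algebra_simps)
    also have "p dvd \<dots> \<longleftrightarrow> p dvd y - z \<or> p dvd y + z" using prime by (rule prime_dvd_mult_iff)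
    finally show ?thesis .
  qed
  consider "chi c = 0" | "chi c = 1" | "chi c = - 1" using chi_values by blast
  then show ?thesis
  proof cases
    case 1
    then have c: "p dvd 0\<^sup>2 - c" by (simp add: chi_eq_0_iff)
    have "{y \<in> {0..<p}. p dvd y\<^sup>2 - c} = {0}"
      using neg[OF c] p_gt_2 eq_iff_dvd[of _ 0] by auto
    with 1 show ?thesis by simp
  next
    case 2
    then obtain z0 where z0: "\<not> p dvd c" "p dvd z0\<^sup>2 - c" by (auto simp: chi_eq_1_iff)
    define z where "z = z0 mod p"
    have z: "0 \<le> z" "z < p" using p_gt_2 by (auto simp: z_def)
    have "p dvd z - z0" by (simp add: z_def)
    with z0(2) have zc: "p dvd z\<^sup>2 - c" by Groebner_Basis.algebra
    have nz: "\<not> p dvd z"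
    proof
      assume "p dvd z"
      with zc have "p dvd c" by Groebner_Basis.algebra
      with z0 show False by simp
    qed
    then have z1: "z \<noteq> 0" by auto
    have "{y \<in> {0..<p}. p dvd y\<^sup>2 - c} = {z, p - z}"
    proof -
      have "p dvd y - z \<longleftrightarrow> y = z" "p dvd y + z \<longleftrightarrow> y = p - z" if "0 \<le> y" "y < p" for y
      proof -
        show "p dvd y - z \<longleftrightarrow> y = z" using eq_iff_dvd[OF that z] by simp
        have "y + z = y - (p - z) + 1 * p" by simp
        then have "p dvd y + z \<longleftrightarrow> p dvd y - (p - z)" by (simp only: dvd_add_times_triv_right_iff)
        then show "p dvd y + z \<longleftrightarrow> y = p - z" using eq_iff_dvd[OF that, of "p - z"] z z1 by simp
      qed
      then show ?thesis using neg[OF zc] z z1 by auto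
    qed
    moreover have "z \<noteq> p - z"
    proof
      assume "z = p - z"
      then have "p dvd 2 * z" by simp
      then show False using nz double_dvd by blast
    qed
    ultimately show ?thesis using 2 by simp
  next
    case 3
    then have e: "{y \<in> {0..<p}. p dvd y\<^sup>2 - c} = {}"
      using chi_eq_1_iff[of c] chi_eq_0_iff[of c] by auto
    show ?thesis by (simp only: e 3 card.empty)
  qed
qed

section \<open>Jacobsthal sums \<open>S n\<close> of the cubics \<open>x ^ 3 - n x\<close> and their
  second moment\<close>

definition S :: "int \<Rightarrow> int" where "S n = (\<Sum>x\<in>{0..<p}. chi x * chi (x\<^sup>2 - n))"

text \<open>Substitute \<open>t * x\<close> for \<open>x\<close>. Consequently, for \<open>n\<close>
  prime to \<open>p\<close>, the value \<open>S n\<close> depends up to sign only on the quadratic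
  character of \<open>n\<close>.\<close>

lemma S_mult_square:
  assumes t: "\<not> p dvd t" shows "S (n * t\<^sup>2) = chi t * S n"
proof -
  have "S (n * t\<^sup>2) = (\<Sum>x\<in>{0..<p}. chi (t * x + 0) * chi ((t * x + 0)\<^sup>2 - n * t\<^sup>2))"
    unfolding S_def
  proof (rule sum_reindex_affine[OF t, symmetric])
    fix x y assume xy: "p dvd x - y"
    then have "p dvd (x\<^sup>2 - n * t\<^sup>2) - (y\<^sup>2 - n * t\<^sup>2)" by Groebner_Basis.algebra
    with xy show "chi x * chi (x\<^sup>2 - n * t\<^sup>2) = chi y * chi (y\<^sup>2 - n * t\<^sup>2)"
      using chi_cong by metis
  qed
  also have "\<dots> = (\<Sum>x\<in>{0..<p}. chi t * (chi x * chi (x\<^sup>2 - n)))"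
  proof (rule sum.cong)
    fix x
    have "(t * x + 0)\<^sup>2 - n * t\<^sup>2 = t\<^sup>2 * (x\<^sup>2 - n)" by (simp add: power2_eq_square algebra_simps)
    then have "chi ((t * x + 0)\<^sup>2 - n * t\<^sup>2) = chi (x\<^sup>2 - n)"
      using chi_square[OF t] by (simp add: chi_mult del: power_mult_distrib)
    then show "chi (t * x + 0) * chi ((t * x + 0)\<^sup>2 - n * t\<^sup>2) = chi t * (chi x * chi (x\<^sup>2 - n))"
      by (simp add: chi_mult)
  qed simp
  also have "\<dots> = chi t * S n" by (simp add: S_def sum_distrib_left)
  finally show ?thesis .
qed

lemma S_cong: "p dvd n - n' \<Longrightarrow> S n = S n'"
  unfolding S_def by (intro sum.cong refl arg_cong2[where f = "(*)"] chi_cong)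
    (simp add: dvd_diff_commute)

lemma S_0: "S 0 = 0"
proof -
  have *: "chi x * chi (x\<^sup>2 - 0) = chi x" for x
    using chi_square[of x] chi_eq_0_iff[of x] by auto
  show ?thesis unfolding S_def by (simp only: * sum_chi)
qed

text \<open>Expand the square and sum over \<open>n\<close> first. The constant \<open>- 1\<close>
  in \<open>sum_chi_product\<close> contributes the square of \<open>sum_chi\<close>, which is 0.
  The term \<open>p\<close> survives only for \<open>y\<close> congruent to \<open>x\<close> or
  \<open>- x\<close>, where \<open>chi y = chi x\<close> because \<open>- 1\<close> is a
  residue.\<close>

lemma sum_S_square:
  assumes "chi (- 1) = 1" shows "(\<Sum>n\<in>{0..<p}. (S n)\<^sup>2) = 2 * p * (p - 1)"
proof -
  let ?A = "{0..<p}"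
  have "(\<Sum>n\<in>?A. (S n)\<^sup>2)
      = (\<Sum>n\<in>?A. \<Sum>x\<in>?A. \<Sum>y\<in>?A. chi x * chi y * (chi (x\<^sup>2 - n) * chi (y\<^sup>2 - n)))"
    by (simp add: S_def power2_eq_square sum_product mult_ac)
  also have "\<dots> = (\<Sum>x\<in>?A. \<Sum>y\<in>?A. \<Sum>n\<in>?A. chi x * chi y * (chi (x\<^sup>2 - n) * chi (y\<^sup>2 - n)))"
    by (subst sum.swap) (intro sum.cong refl sum.swap)
  also have "\<dots> = (\<Sum>x\<in>?A. \<Sum>y\<in>?A. chi x * chi y * ((if p dvd x\<^sup>2 - y\<^sup>2 then p else 0) - 1))"
    by (simp only: sum_chi_product flip: sum_distrib_left)
  also have "\<dots> = (\<Sum>x\<in>?A. p * (chi x * (\<Sum>y\<in>?A. if p dvd x\<^sup>2 - y\<^sup>2 then chi y else 0)))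
      - (\<Sum>x\<in>?A. \<Sum>y\<in>?A. chi x * chi y)"
    unfolding sum_subtractf[symmetric] sum_distrib_left
    by (intro sum.cong refl) (simp add: algebra_simps)
  also have "(\<Sum>x\<in>?A. \<Sum>y\<in>?A. chi x * chi y) = 0"
    using sum_product[of chi ?A chi ?A] sum_chi by simp
  also have "(\<Sum>x\<in>?A. p * (chi x * (\<Sum>y\<in>?A. if p dvd x\<^sup>2 - y\<^sup>2 then chi y else 0)))
      = (\<Sum>x\<in>?A. 2 * p * (chi x)\<^sup>2)"
  proof (rule sum.cong)
    fix x assume x: "x \<in> ?A"
    have "chi x * (\<Sum>y\<in>?A. if p dvd x\<^sup>2 - y\<^sup>2 then chi y else 0) = 2 * (chi x)\<^sup>2"
    proof (cases "p dvd x")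
      case True
      then show ?thesis by (simp add: chi_eq_0_iff[symmetric])
    next
      case False
      have "(\<Sum>y\<in>?A. if p dvd x\<^sup>2 - y\<^sup>2 then chi y else 0) =
          (\<Sum>y\<in>{y \<in> ?A. p dvd y\<^sup>2 - x\<^sup>2}. chi y)"
        unfolding dvd_diff_commute[of p "x\<^sup>2"] by (rule sum.inter_filter[symmetric]) simp
      also have "\<dots> = (\<Sum>y\<in>{y \<in> ?A. p dvd y\<^sup>2 - x\<^sup>2}. chi x)"
      proof (rule sum.cong)
        fix y assume "y \<in> {y \<in> ?A. p dvd y\<^sup>2 - x\<^sup>2}"
        then have "p dvd (y - x) * (y + x)" by (simp add: power2_eq_square algebra_simps)
        then have "p dvd y - x \<or> p dvd y - (- 1) * x" using prime by (simp add: prime_dvd_mult_iff)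
        then show "chi y = chi x" using assms chi_cong chi_mult[of "- 1" x] by (metis mult_1)
      qed simp
      also have "\<dots> = 2 * chi x" using card_square_roots[of "x\<^sup>2"] chi_square[OF False] by simp
      finally show ?thesis by (simp add: power2_eq_square)
    qed
    then show "p * (chi x * (\<Sum>y\<in>?A. if p dvd x\<^sup>2 - y\<^sup>2 then chi y else 0)) = 2 * p * (chi x)\<^sup>2"
      by simp
  qed simp
  also have "\<dots> = 2 * p * (p - 1)" by (simp add: sum_chi_square flip: sum_distrib_left)
  finally show ?thesis by simp
qed

text \<open>The squares of \<open>S n\<close> take only two values at nonzero \<open>n\<close>, one
  on the residues and one on the nonresidues, and the second moment determines their sum.\<close>

theorem jacobsthal:
  assumes "chi (- 1) = 1" and r: "chi r = - 1" shows "(S 1)\<^sup>2 + (S r)\<^sup>2 = 4 * p"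
proof -
  \<comment> \<open>The coefficients \<open>1 + chi n\<close> and \<open>1 - chi n\<close> select
    the right case, so the formula can be summed over \<open>n\<close> without splitting the
    range.\<close>
  have n: "2 * (S n)\<^sup>2 = (1 + chi n) * (S 1)\<^sup>2 + (1 - chi n) * (S r)\<^sup>2" if "\<not> p dvd n" for n
  proof (cases "chi n = 1")
    case True
    then obtain y where y: "p dvd y\<^sup>2 - n" by (auto simp: chi_eq_1_iff)
    have y0: "\<not> p dvd y"
    proof
      assume "p dvd y"
      with y have "p dvd n" by Groebner_Basis.algebra
      with that show False by simp
    qed
    have "S n = S (1 * y\<^sup>2)" using y by (intro S_cong) (simp add: dvd_diff_commute)
    also have "\<dots> = chi y * S 1" by (rule S_mult_square[OF y0])
    finally show ?thesis using True y0 by (simp add: power_mult_distrib chi_square_values)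
  next
    case False
    then have c: "chi n = - 1" using that chi_values chi_eq_0_iff by blast
    then have "chi (n * r) = 1" using r by (simp add: chi_mult)
    then obtain y where y: "p dvd y\<^sup>2 - n * r" "\<not> p dvd n * r" by (auto simp: chi_eq_1_iff)
    have y0: "\<not> p dvd y"
    proof
      assume "p dvd y"
      with y(1) have "p dvd n * r" by Groebner_Basis.algebra
      with y show False by simp
    qed
    have n0: "\<not> p dvd n" "\<not> p dvd r" using y(2) by auto
    \<comment> \<open>Since \<open>y\<^sup>2\<close> is congruent to \<open>n * r\<close>, the
      arguments agree. Removing the square \<open>y\<^sup>2\<close> on the left and
      \<open>r\<^sup>2\<close> on the right compares \<open>S r\<close> with
      \<open>S n\<close>.\<close>
    have "S (r * y\<^sup>2) = S (n * r\<^sup>2)"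
    proof (rule S_cong)
      show "p dvd r * y\<^sup>2 - n * r\<^sup>2" using y(1) by Groebner_Basis.algebra
    qed
    then have "chi y * S r = chi r * S n" using S_mult_square y0 n0 by simp
    then have "(chi y)\<^sup>2 * (S r)\<^sup>2 = (chi r)\<^sup>2 * (S n)\<^sup>2" by (metis power_mult_distrib)
    then show ?thesis using c y0 n0 by (simp add: chi_square_values)
  qed
  have s0: "sum f {0..<p} = f 0 + sum f {1..<p}" for f :: "int \<Rightarrow> int"
    unfolding residues_remove_0 by (rule sum.insert) auto
  have chi0: "chi 0 = 0" by (simp add: chi_eq_0_iff)
  have "2 * (2 * p * (p - 1)) = (\<Sum>n\<in>{1..<p}. 2 * (S n)\<^sup>2)"
    using sum_S_square[OF assms(1)] s0[of "\<lambda>n. (S n)\<^sup>2"] S_0 by (simp flip: sum_distrib_left)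
  also have "\<dots> = (\<Sum>n\<in>{1..<p}. ((S 1)\<^sup>2 + (S r)\<^sup>2) + ((S 1)\<^sup>2 - (S r)\<^sup>2) * chi n)"
    using n not_dvd_pos by (intro sum.cong) (auto simp: algebra_simps)
  also have "\<dots> = (p - 1) * ((S 1)\<^sup>2 + (S r)\<^sup>2)"
    using p_gt_2 s0[of chi] chi0 sum_chi by (simp add: sum.distrib flip: sum_distrib_left)
  finally have "(p - 1) * (4 * p) = (p - 1) * ((S 1)\<^sup>2 + (S r)\<^sup>2)" by (simp add: algebra_simps)
  then show ?thesis using p_gt_2 by simp
qed

end

section \<open>Uniqueness of a prime as a sum of two squares\<close>

lemma prime_two_squares_unique:
  fixes p a b u v :: int
  assumes p: "prime p" and ab: "a\<^sup>2 + b\<^sup>2 = p" and uv: "u\<^sup>2 + v\<^sup>2 = p"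
  shows "a\<^sup>2 = u\<^sup>2 \<or> a\<^sup>2 = v\<^sup>2"
proof -
  have key: "a\<^sup>2 = u\<^sup>2 \<or> a\<^sup>2 = v\<^sup>2" if ab: "a\<^sup>2 + b\<^sup>2 = p" and d: "p dvd a * v - b * u" for b
  proof -
    have p0: "p > 0" using p by (simp add: prime_gt_0_int)
    \<comment> \<open>Brahmagupta's identity writes \<open>p\<^sup>2\<close> as a sum of two
      squares. One root is divisible by \<open>p\<close>, so it is 0 or else the other root is
      0.\<close>
    have "(a * v - b * u)\<^sup>2 + (a * u + b * v)\<^sup>2 = (a\<^sup>2 + b\<^sup>2) * (u\<^sup>2 + v\<^sup>2)"
      by Groebner_Basis.algebra
    then have sq: "(a * v - b * u)\<^sup>2 + (a * u + b * v)\<^sup>2 = p\<^sup>2"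
      unfolding ab uv by (simp only: power2_eq_square)
    show ?thesis
    proof (cases "a * v - b * u = 0")
      case True
      then have "p * (a\<^sup>2 - u\<^sup>2) = 0" using ab uv by Groebner_Basis.algebra
      with p0 show ?thesis by simp
    next
      case False
      then have "p \<le> \<bar>a * v - b * u\<bar>" using dvd_imp_le_int[OF _ d] p0 by simp
      then have "p\<^sup>2 \<le> (a * v - b * u)\<^sup>2" using p0 by (simp add: abs_le_square_iff[symmetric])
      with sq have "(a * u + b * v)\<^sup>2 \<le> 0" by linarith
      then have "a * u + b * v = 0" by simp
      then have "p * (a\<^sup>2 - v\<^sup>2) = 0" using ab uv by Groebner_Basis.algebra
      with p0 show ?thesis by simp
    qed
  qed
  \<comment> \<open>The product is a multiple of \<open>p\<close>, so \<open>p\<close> divides one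
    of the factors; changing the sign of \<open>b\<close> exchanges them.\<close>
  have "(a * v - b * u) * (a * v + b * u) = a\<^sup>2 * v\<^sup>2 - b\<^sup>2 * u\<^sup>2"
    by Groebner_Basis.algebra
  also have "v\<^sup>2 = p - u\<^sup>2" using uv by simp
  also have "b\<^sup>2 = p - a\<^sup>2" using ab by simp
  finally have "(a * v - b * u) * (a * v + b * u) = p * (a\<^sup>2 - u\<^sup>2)"
    by (simp add: algebra_simps)
  then have "p dvd (a * v - b * u) * (a * v - (- b) * u)" by simp
  then have "p dvd a * v - b * u \<or> p dvd a * v - (- b) * u"
    using p prime_dvd_mult_iff by blast
  then show ?thesis using key[of b] key[of "- b"] ab by auto
qed

section \<open>The chord-and-tangent law modulo a prime\<close>

locale weierstrass_mod = odd_prime p for p +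
  fixes a b :: int
  assumes nonsingular: "p dvd x ^ 3 + a * x + b \<Longrightarrow> \<not> p dvd 3 * x\<^sup>2 + a"
begin

text \<open>
  The last three conditions compare the coefficients in
  \<open>x\<^sup>3 + a x + b - (l x + c)\<^sup>2 = (x - x1) (x - x2) (x - x3)\<close>, so tangent lines are included.
\<close>

definition collinear :: "int \<Rightarrow> int \<Rightarrow> int \<Rightarrow> int \<Rightarrow> int \<Rightarrow> int \<Rightarrow> int \<Rightarrow> int \<Rightarrow> bool" where
  "collinear x1 y1 x2 y2 x3 y3 l c \<longleftrightarrow>
     p dvd y1 - (l * x1 + c) \<and> p dvd y2 - (l * x2 + c) \<and> p dvd y3 - (l * x3 + c) \<and>
     p dvd l\<^sup>2 - (x1 + x2 + x3) \<and>
     p dvd a - 2 * l * c - (x1 * x2 + x1 * x3 + x2 * x3) \<and>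
     p dvd b - c\<^sup>2 + x1 * x2 * x3"

lemma collinear_rotate: "collinear x1 y1 x2 y2 x3 y3 l c \<Longrightarrow> collinear x2 y2 x3 y3 x1 y1 l c"
  by (simp add: collinear_def algebra_simps)

lemma collinear_swap: "collinear x1 y1 x2 y2 x3 y3 l c \<Longrightarrow> collinear x2 y2 x1 y1 x3 y3 l c"
  by (simp add: collinear_def algebra_simps)

lemma collinear_neg:
  "collinear x1 y1 x2 y2 x3 y3 l c \<Longrightarrow> collinear x1 (- y1) x2 (- y2) x3 (- y3) (- l) (- c)"
  unfolding collinear_def by (elim conjE, intro conjI; Groebner_Basis.algebra)

lemma collinear_chord:
  assumes "collinear x1 y1 x2 y2 x3 y3 l c"
  shows "p dvd y1 - (l * x1 + c)" "p dvd y2 - y1 - l * (x2 - x1)"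
  using assms unfolding collinear_def by (blast, Groebner_Basis.algebra)

lemma collinear_on_curve:
  "collinear x1 y1 x2 y2 x3 y3 l c \<Longrightarrow> p dvd y1\<^sup>2 - (x1 ^ 3 + a * x1 + b)"
  unfolding collinear_def by Groebner_Basis.algebra

text \<open>On a line with a slope, points of equal abscissa have equal ordinates. If they were also
  opposite, the ordinate would vanish and \<open>x1\<close> would be a double root of the
  cubic.\<close>

lemma collinear_not_opposite:
  assumes "collinear x1 y1 x2 y2 x3 y3 l c" "p dvd x2 - x1" shows "\<not> p dvd y2 + y1"
proof
  assume y: "p dvd y2 + y1"
  from assms y have "p dvd 2 * y1" unfolding collinear_def by Groebner_Basis.algebra
  then have y1: "p dvd y1" by (rule double_dvd)
  from assms y1 have "p dvd 3 * x1\<^sup>2 + a" unfolding collinear_def by Groebner_Basis.algebra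
  moreover from collinear_on_curve[OF assms(1)] y1 have "p dvd x1 ^ 3 + a * x1 + b"
    by Groebner_Basis.algebra
  ultimately show False using nonsingular by blast
qed

text \<open>Chords and tangents alike satisfy \<open>l * (x2 - x1) = y2 - y1\<close> and
  \<open>l * (y1 + y2) = x1\<^sup>2 + x1 * x2 + x2\<^sup>2 + a\<close> modulo \<open>p\<close>. The
  coefficients of \<open>l\<close> do not both vanish, so the slope is determined.\<close>

lemma collinear_unique:
  assumes "collinear x1 y1 x2 y2 x3 y3 l c" "collinear x1 y1 x2 y2 x3' y3' l' c'"
  shows "p dvd x3 - x3'" "p dvd y3 - y3'"
proof -
  have l: "p dvd l - l'"
  proof (rule ccontr)
    assume n: "\<not> p dvd l - l'"
    from assms have "p dvd (l - l') * (x2 - x1)" unfolding collinear_def by Groebner_Basis.algebra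
    moreover from assms have "p dvd (l - l') * (y2 + y1)"
      unfolding collinear_def by Groebner_Basis.algebra
    ultimately show False using n collinear_not_opposite[OF assms(1)] dvd_mult_cancel by blast
  qed
  then show x: "p dvd x3 - x3'" using assms unfolding collinear_def by Groebner_Basis.algebra
  from assms l have c: "p dvd c - c'" unfolding collinear_def by Groebner_Basis.algebra
  from assms l c x show "p dvd y3 - y3'" unfolding collinear_def by Groebner_Basis.algebra
qed

lemma collinear_same_abscissa:
  assumes "collinear x1 y1 x2 y2 x3 y3 l c" "p dvd x2 - x1"
  shows "p dvd y2 - y1" "\<not> p dvd y1"
proof -
  from assms show y: "p dvd y2 - y1" unfolding collinear_def by Groebner_Basis.algebra
  from collinear_not_opposite[OF assms] y show "\<not> p dvd y1"
    by (metis add.commute diff_add_cancel dvd_add)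
qed

text \<open>At the abscissa of the point \<open>(x3, y3)\<close>, the cubic minus the square of the
  first line is \<open>(x3 - x1) * (x3 - x2) * (x3 - s)\<close>. As a difference of squares it is
  also the product of \<open>(x3 - s) * (l1 + l2)\<close> and \<open>(x3 - x2) * (l3 - l1)\<close>.
  Cancelling gives the claim; the cases where this fails are tangencies.\<close>

lemma slope_relation:
  assumes PQ: "collinear x1 y1 x2 y2 s (- t) l1 c1"
    and SR: "collinear s t x3 y3 u w l2 c2"
    and QR: "collinear x2 y2 x3 y3 s' w' l3 c3"
  shows "p dvd (l1 + l2) * (l3 - l1) - (x3 - x1)"
proof -
  let ?D = "(l1 + l2) * (l3 - l1) - (x3 - x1)"
  have e1: "p dvd (x3 - s) * (l1 + l2) - (y3 + l1 * x3 + c1)"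
    using collinear_chord(1)[OF PQ[THEN collinear_rotate, THEN collinear_rotate]]
      collinear_chord(2)[OF SR] by Groebner_Basis.algebra
  have e2: "p dvd (y3 - l1 * x3 - c1) - (l3 - l1) * (x3 - x2)"
    using collinear_chord(1)[OF PQ[THEN collinear_swap]] collinear_chord(2)[OF QR] by Groebner_Basis.algebra
  have e3: "p dvd y3\<^sup>2 - (l1 * x3 + c1)\<^sup>2 - (x3 - x1) * (x3 - x2) * (x3 - s)"
    using PQ collinear_on_curve[OF QR[THEN collinear_swap]] unfolding collinear_def by Groebner_Basis.algebra
  consider "\<not> p dvd x3 - x2" "\<not> p dvd x3 - s" | "p dvd x3 - s" "\<not> p dvd x3 - x2"
    | "p dvd x3 - x2" "\<not> p dvd x3 - s" | "p dvd x3 - x2" "p dvd x3 - s"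
    by blast
  then show ?thesis
  proof cases
    case 1
    have "p dvd (x3 - x2) * ((x3 - s) * ?D)" using e1 e2 e3 by Groebner_Basis.algebra
    then show ?thesis using 1 dvd_mult_cancel by blast
  next
    \<comment> \<open>Here \<open>(x3, y3)\<close> equals \<open>(s, t)\<close>, so
      \<open>l2\<close> is a tangent slope, as \<open>d2\<close> states. The congruence
      \<open>d3\<close> is the derivative at \<open>s\<close> of the factorisation belonging to the
      first line.\<close>
    case 2
    note y = collinear_same_abscissa[OF SR 2(1)]
    have d1: "p dvd (l3 - l1) * (s - x2) - 2 * t"
      using collinear_chord(2)[OF PQ[THEN collinear_rotate]]
        collinear_chord(2)[OF QR] 2(1) y(1) by Groebner_Basis.algebra
    have d2: "p dvd 2 * t * l2 - (3 * s\<^sup>2 + a)"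
      using SR 2(1) y(1) unfolding collinear_def by Groebner_Basis.algebra
    have d3: "p dvd 3 * s\<^sup>2 + a + 2 * l1 * t - (s - x1) * (s - x2)"
      using PQ unfolding collinear_def by Groebner_Basis.algebra
    have "p dvd (s - x2) * ?D" using d1 d2 d3 2(1) by Groebner_Basis.algebra
    moreover have "\<not> p dvd s - x2" using 2 by (metis diff_add_cancel dvd_add add_diff_eq)
    ultimately show ?thesis using dvd_mult_cancel by blast
  next
    \<comment> \<open>Here \<open>(x3, y3)\<close> equals \<open>(x2, y2)\<close>, so
      \<open>l3\<close> is the tangent slope; the first factorisation is differentiated at
      \<open>x2\<close>.\<close>
    case 3
    note y = collinear_same_abscissa[OF QR 3(1)]
    have d0: "p dvd (x3 - s) * (l1 + l2) - 2 * y2"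
      using e1 PQ 3(1) y(1) unfolding collinear_def by Groebner_Basis.algebra
    have d2: "p dvd 2 * y2 * l3 - (3 * x2\<^sup>2 + a)"
      using QR 3(1) y(1) unfolding collinear_def by Groebner_Basis.algebra
    have d3: "p dvd 3 * x2\<^sup>2 + a - 2 * l1 * y2 - (x2 - x1) * (x2 - s)"
      using PQ unfolding collinear_def by Groebner_Basis.algebra
    have "p dvd (x3 - s) * ?D" using d0 d2 d3 3(1) by Groebner_Basis.algebra
    then show ?thesis using 3 dvd_mult_cancel by blast
  next
    \<comment> \<open>All of \<open>(s, t)\<close>, \<open>(x3, y3)\<close> and
      \<open>(x2, y2)\<close> would coincide, which puts the opposite points \<open>(x2, y2)\<close>
      and \<open>(s, - t)\<close> on the first line.\<close>
    case 4
    then have "p dvd s - x2" by (metis add_diff_cancel_left' diff_diff_eq2 dvd_diff)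
    moreover have "p dvd - t + y2"
      using collinear_same_abscissa(1)[OF SR 4(2)] collinear_same_abscissa(1)[OF QR 4(1)]
      by Groebner_Basis.algebra
    ultimately show ?thesis
      using collinear_not_opposite[OF PQ[THEN collinear_rotate]] by (simp add: dvd_diff_commute)
  qed
qed

text \<open>The slope relation and its mirror image give \<open>l1 + l2 = l3 + l4\<close> modulo
  \<open>p\<close> unless \<open>l1\<close> and \<open>l3\<close> agree. In that case the first and
  the third point would be equal, contrary to \<open>PR\<close>.\<close>

lemma collinear_assoc:
  assumes PQ: "collinear x1 y1 x2 y2 s (- t) l1 c1"
    and SR: "collinear s t x3 y3 u (- v) l2 c2"
    and QR: "collinear x2 y2 x3 y3 s' (- t') l3 c3"
    and PS: "collinear x1 y1 s' t' u' (- v') l4 c4"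
    and PR: "\<not> (p dvd x3 - x1 \<and> p dvd y3 - y1)"
  shows "p dvd u - u'" "p dvd v - v'"
proof -
  have e1: "p dvd (l1 + l2) * (l3 - l1) - (x3 - x1)"
    by (rule slope_relation[OF PQ SR QR])
  have e2: "p dvd (l3 + l4) * (l1 - l3) - (x1 - x3)"
    by (rule slope_relation[OF QR[THEN collinear_swap] PS[THEN collinear_swap] PQ[THEN collinear_swap]])
  have n: "\<not> p dvd l3 - l1"
  proof
    assume l: "p dvd l3 - l1"
    then have x: "p dvd x3 - x1" using e1 by Groebner_Basis.algebra
    then have "p dvd y3 - y1" using l PQ QR unfolding collinear_def by Groebner_Basis.algebra
    with x PR show False by blast
  qed
  have "p dvd (l3 - l1) * (l1 + l2 - l3 - l4)" using e1 e2 by Groebner_Basis.algebra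
  then have g: "p dvd l1 + l2 - l3 - l4" using n dvd_mult_cancel by blast
  have s: "p dvd l1\<^sup>2 - (x1 + x2 + s)" "p dvd l3\<^sup>2 - (x2 + x3 + s')"
    "p dvd l2\<^sup>2 - (s + x3 + u)" "p dvd l4\<^sup>2 - (x1 + s' + u')"
    using PQ SR QR PS by (auto simp: collinear_def)
  show u: "p dvd u - u'" using g s e1 by Groebner_Basis.algebra
  have w: "p dvd y3 - y2 - l3 * (x3 - x2)" "p dvd y1 - y2 - l1 * (x1 - x2)"
    by (rule collinear_chord(2)[OF QR] collinear_chord(2)[OF PQ[THEN collinear_swap]])+
  have z: "p dvd - v - y3 - l2 * (u - x3)" "p dvd - v' - y1 - l4 * (u' - x1)"
    by (rule collinear_chord(2)[OF SR[THEN collinear_rotate]]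
        collinear_chord(2)[OF PS[THEN collinear_swap, THEN collinear_rotate]])+
  \<comment> \<open>Thus \<open>u\<close> is \<open>x2 + g\<^sup>2 - g * (l1 + l3)\<close> with
    \<open>g\<close> the common sum of slopes, an expression symmetric in \<open>l1\<close> and
    \<open>l3\<close>.\<close>
  have "p dvd u - x2 + (l1 + l2) * (l3 + l1) - (l1 + l2)\<^sup>2" 
    using s e1 by Groebner_Basis.algebra
  then show "p dvd v - v'" using w z g e1 u by Groebner_Basis.algebra
qed

section \<open>From congruences to the operations of the residue ring\<close>

abbreviation "R \<equiv> residue_ring p"
abbreviation "G \<equiv> ec_group R a b"

sublocale residues p R
  using p_gt_2 by unfold_locales auto

lemma field_R: "field R"
proof -
  have "prime (nat p)" using prime prime_int_nat_transfer by blast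
  then have "residues_prime (nat p)" by (rule residues_prime.intro)
  from residues_prime.is_field[OF this] show ?thesis using p_gt_2 by simp
qed

lemma res_minus_eq: "x \<ominus>\<^bsub>R\<^esub> y = (x - y) mod p"
  by (simp add: a_minus_def res_add_eq res_neg_eq mod_simps)

lemma res_pow_eq: "x [^]\<^bsub>R\<^esub> (n::nat) = x ^ n mod p"
  by (induction n) (use p_gt_2 in \<open>simp_all add: res_one_eq res_mult_eq mod_mult_right_eq mult.commute\<close>)

lemma res_add_pow_eq: "[(n::nat)] \<cdot>\<^bsub>R\<^esub> x = int n * x mod p"
  by (induction n) (simp_all add: res_zero_eq res_add_eq mod_add_right_eq distrib_right add.commute)

lemmas res_eqs = res_minus_eq res_pow_eq res_add_pow_eq res_add_eq res_mult_eq res_neg_eq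

lemma dvd_mod_minus_iff: "p dvd x mod p - y \<longleftrightarrow> p dvd x - y"
  by (metis mod_eq_dvd_iff mod_mod_trivial)

lemma res_inv:
  assumes "0 \<le> u" "u < p" "\<not> p dvd u"
  shows "p dvd u * inv\<^bsub>R\<^esub> u - 1"
proof -
  have "u \<noteq> 0" using assms(3) by auto
  then have "u \<in> carrier R - {\<zero>\<^bsub>R\<^esub>}" using assms by (simp add: res_carrier_eq res_zero_eq)
  then have "u \<in> Units R" using field.field_Units[OF field_R] by simp
  then have "u \<otimes>\<^bsub>R\<^esub> inv\<^bsub>R\<^esub> u = 1" using Units_r_inv res_one_eq by simp
  then have "(u * inv\<^bsub>R\<^esub> u) mod p = 1 mod p" using p_gt_2 by (simp add: res_mult_eq)
  then show ?thesis by (simp add: mod_eq_dvd_iff)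
qed

lemma Affine_in_G:
  "Affine x y \<in> carrier G \<longleftrightarrow>
     0 \<le> x \<and> x < p \<and> 0 \<le> y \<and> y < p \<and> p dvd y\<^sup>2 - (x ^ 3 + a * x + b)"
proof -
  have eq: "(x ^ 3 + a * x mod p + b) mod p = (x ^ 3 + a * x + b) mod p"
    by (metis mod_add_left_eq mod_add_right_eq)
  have "Affine x y \<in> carrier G \<longleftrightarrow>
     0 \<le> x \<and> x < p \<and> 0 \<le> y \<and> y < p \<and> y\<^sup>2 mod p = (x ^ 3 + a * x + b) mod p"
    by (auto simp: ec_group_def ec_points_def res_carrier_eq res_eqs mod_add_left_eq eq)
  then show ?thesis by (simp only: mod_eq_dvd_iff)
qed

lemma Infinity_in_G [simp]: "Infinity \<in> carrier G"
  by (simp add: ec_group_def ec_points_def)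

lemma one_G [simp]: "\<one>\<^bsub>G\<^esub> = Infinity"
  by (simp add: ec_group_def)

lemma mult_G [simp]: "x \<otimes>\<^bsub>G\<^esub> y = ec_add R a x y"
  by (simp add: ec_group_def)

text \<open>The second condition is the slope equation multiplied by \<open>y1 + y2\<close>. Unlike
  the first, it still determines the slope when the points coincide, so both branches of
  \<open>ec_add\<close> fit.\<close>

lemma collinear_of_slope:
  assumes "p dvd l * (x2 - x1) - (y2 - y1)"
    and "p dvd l * (y1 + y2) - (x1\<^sup>2 + x1 * x2 + x2\<^sup>2 + a)"
    and "p dvd y1\<^sup>2 - (x1 ^ 3 + a * x1 + b)"
    and "p dvd s - (l\<^sup>2 - x1 - x2)"
    and "p dvd t - (l * (x1 - s) - y1)"
  shows "collinear x1 y1 x2 y2 s (- t) l (y1 - l * x1)"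
  unfolding collinear_def
proof (intro conjI)
  show "p dvd y1 - (l * x1 + (y1 - l * x1))" by simp
  show "p dvd y2 - (l * x2 + (y1 - l * x1))" using assms(1) by Groebner_Basis.algebra
  show "p dvd - t - (l * s + (y1 - l * x1))" using assms(5) by Groebner_Basis.algebra
  show "p dvd l\<^sup>2 - (x1 + x2 + s)" using assms(4) by Groebner_Basis.algebra
  show e: "p dvd a - 2 * l * (y1 - l * x1) - (x1 * x2 + x1 * s + x2 * s)"
    using assms(1,2,4) by Groebner_Basis.algebra
  show "p dvd b - (y1 - l * x1)\<^sup>2 + x1 * x2 * s"
    using assms(3,4) e by Groebner_Basis.algebra
qed

lemma add_affine:
  assumes P: "Affine x1 y1 \<in> carrier G" and Q: "Affine x2 y2 \<in> carrier G"
    and n: "\<not> (p dvd x2 - x1 \<and> p dvd y2 + y1)"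
  obtains s t l c where "ec_add R a (Affine x1 y1) (Affine x2 y2) = Affine s t"
    "Affine s t \<in> carrier G" "collinear x1 y1 x2 y2 s (- t) l c"
proof -
  note P' = P[unfolded Affine_in_G] and Q' = Q[unfolded Affine_in_G]
  define l where "l = (if x1 = x2
                then ([(3::nat)] \<cdot>\<^bsub>R\<^esub> (x1 [^]\<^bsub>R\<^esub> (2::nat)) \<oplus>\<^bsub>R\<^esub> a) \<otimes>\<^bsub>R\<^esub> inv\<^bsub>R\<^esub> ([(2::nat)] \<cdot>\<^bsub>R\<^esub> y1)
                else (y2 \<ominus>\<^bsub>R\<^esub> y1) \<otimes>\<^bsub>R\<^esub> inv\<^bsub>R\<^esub> (x2 \<ominus>\<^bsub>R\<^esub> x1))"
  define s where "s = (l\<^sup>2 - x1 - x2) mod p"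
  define t where "t = (l * (x1 - s) - y1) mod p"
  have n': "\<not> (x1 = x2 \<and> y1 = \<ominus>\<^bsub>R\<^esub> y2)"
  proof
    assume *: "x1 = x2 \<and> y1 = \<ominus>\<^bsub>R\<^esub> y2"
    then have "p dvd y1 - (- y2)" by (metis mod_dvd(2) res_neg_eq)
    with n * show False by (simp add: add.commute)
  qed
  have "l [^]\<^bsub>R\<^esub> (2::nat) \<ominus>\<^bsub>R\<^esub> x1 \<ominus>\<^bsub>R\<^esub> x2 = s"
    by (simp add: s_def res_eqs mod_simps)
  moreover have "l \<otimes>\<^bsub>R\<^esub> (x1 \<ominus>\<^bsub>R\<^esub> s) \<ominus>\<^bsub>R\<^esub> y1 = t"
    by (simp add: t_def res_eqs mod_simps)
  ultimately have eq: "ec_add R a (Affine x1 y1) (Affine x2 y2) = Affine s t"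
    using n' by (simp only: ec_add.simps if_False Let_def flip: l_def)
  have "p dvd l * (x2 - x1) - (y2 - y1) \<and> p dvd l * (y1 + y2) - (x1\<^sup>2 + x1 * x2 + x2\<^sup>2 + a)"
  proof (cases "x1 = x2")
    case True
    have "p dvd (y2 + y1) * (y2 - y1)"
      using P' Q' True by Groebner_Basis.algebra
    moreover have "\<not> p dvd y2 + y1" using n True by auto
    ultimately have "p dvd y2 - y1" using dvd_mult_cancel by blast
    then have y: "y2 = y1" using P' Q' eq_iff_dvd by blast
    have "\<not> p dvd 2 * y1" using \<open>\<not> p dvd y2 + y1\<close> y by simp
    then have "p dvd (2 * y1 mod p) * inv\<^bsub>R\<^esub> (2 * y1 mod p) - 1"
      using p_gt_2 by (intro res_inv) (auto simp: dvd_mod_iff)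
    moreover define i where "i = inv\<^bsub>R\<^esub> (2 * y1 mod p)"
    moreover have "p dvd 2 * y1 mod p - 2 * y1" by simp
    moreover have "p dvd l - (3 * x1\<^sup>2 + a) * i"
      using True by (simp add: l_def res_eqs i_def mod_simps dvd_mod_minus_iff)
    ultimately have "p dvd l * (2 * y1) - (3 * x1\<^sup>2 + a)" by Groebner_Basis.algebra
    with True y show ?thesis by (simp add: power2_eq_square)
  next
    case False
    then have "\<not> p dvd x2 - x1" using P' Q' eq_iff_dvd by blast
    then have "p dvd ((x2 - x1) mod p) * inv\<^bsub>R\<^esub> ((x2 - x1) mod p) - 1"
      using p_gt_2 by (intro res_inv) (auto simp: dvd_mod_iff)
    moreover define i where "i = inv\<^bsub>R\<^esub> ((x2 - x1) mod p)"
    moreover have "p dvd (x2 - x1) mod p - (x2 - x1)" by simp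
    moreover have "p dvd l - (y2 - y1) * i"
      using False by (simp add: l_def res_eqs i_def mod_simps dvd_mod_minus_iff)
    ultimately have e: "p dvd l * (x2 - x1) - (y2 - y1)" by Groebner_Basis.algebra
    \<comment> \<open>Multiplied by \<open>x2 - x1\<close>, the term with \<open>l\<close> becomes
      \<open>y2\<^sup>2 - y1\<^sup>2\<close>, a difference of two values of the cubic, which has the
      factor \<open>x2 - x1\<close>.\<close>
    moreover have "p dvd (x2 - x1) * (l * (y1 + y2) - (x1\<^sup>2 + x1 * x2 + x2\<^sup>2 + a))"
      using e P' Q' by Groebner_Basis.algebra
    ultimately show ?thesis using \<open>\<not> p dvd x2 - x1\<close> dvd_mult_cancel by blast
  qed
  then have col: "collinear x1 y1 x2 y2 s (- t) l (y1 - l * x1)"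
    using P' by (intro collinear_of_slope) (auto simp: s_def t_def)
  have "p dvd (- t)\<^sup>2 - (s ^ 3 + a * s + b)"
    by (rule collinear_on_curve[OF col[THEN collinear_rotate, THEN collinear_rotate]])
  then have "Affine s t \<in> carrier G"
    using p_gt_2 by (simp add: Affine_in_G s_def t_def)
  from that[OF eq this col] show ?thesis .
qed

lemma add_opposite:
  assumes "Affine x1 y1 \<in> carrier G" "Affine x2 y2 \<in> carrier G" "p dvd x2 - x1" "p dvd y2 + y1"
  shows "ec_add R a (Affine x1 y1) (Affine x2 y2) = Infinity"
proof -
  have "x1 = x2" using assms(1-3) by (metis Affine_in_G eq_iff_dvd)
  moreover have "p dvd y1 - (- y2)" using assms(4) by (simp add: add.commute)
  then have "y1 = (- y2) mod p"
    using assms(1) by (metis Affine_in_G mod_eq_dvd_iff mod_pos_pos_trivial)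
  ultimately show ?thesis by (simp add: res_neg_eq)
qed

text \<open>A sum can be verified by exhibiting any line through the points, without evaluating an
  inverse in the residue ring.\<close>

lemma add_affineI:
  assumes "Affine x1 y1 \<in> carrier G" "Affine x2 y2 \<in> carrier G" "Affine s t \<in> carrier G"
    and col: "collinear x1 y1 x2 y2 s' t' l c" and s: "p dvd s' - s" and t: "p dvd t' + t"
  shows "ec_add R a (Affine x1 y1) (Affine x2 y2) = Affine s t"
proof -
  obtain u v l' c' where add: "ec_add R a (Affine x1 y1) (Affine x2 y2) = Affine u v"
    "Affine u v \<in> carrier G" "collinear x1 y1 x2 y2 u (- v) l' c'"
    using add_affine[OF assms(1,2)] collinear_not_opposite[OF col] by metis
  have "p dvd s' - u" "p dvd t' - (- v)" using collinear_unique[OF col add(3)] by auto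
  with s t have "p dvd u - s" "p dvd v - t" by Groebner_Basis.algebra+
  then have "u = s" "v = t"
    using add(2) assms(3) eq_iff_dvd unfolding Affine_in_G by blast+
  with add(1) show ?thesis by simp
qed

lemma collinear_cong:
  assumes "collinear x1 y1 x2 y2 x3 y3 l c" "p dvd y1' - y1"
  shows "collinear x1 y1' x2 y2 x3 y3 l c"
proof -
  have "p dvd y1' - (l * x1 + c)"
    using collinear_chord(1)[OF assms(1)] assms(2) by Groebner_Basis.algebra
  then show ?thesis using assms(1) by (simp add: collinear_def)
qed

lemma add_Infinity [simp]: "ec_add R a P Infinity = P"
  by (cases P) auto

lemma neg_mod_dvd: "p dvd (- y) mod p + y"
  using mod_dvd(2)[of "- y"] by (simp only: diff_minus_eq_add)

lemma neg_in_G: "Affine x y \<in> carrier G \<Longrightarrow> Affine x ((- y) mod p) \<in> carrier G"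
proof -
  assume "Affine x y \<in> carrier G"
  then have *: "0 \<le> x" "x < p" "p dvd y\<^sup>2 - (x ^ 3 + a * x + b)" by (auto simp: Affine_in_G)
  from neg_mod_dvd[of y] *(3) have "p dvd ((- y) mod p)\<^sup>2 - (x ^ 3 + a * x + b)" by Groebner_Basis.algebra
  with * show ?thesis using p_gt_2 by (simp add: Affine_in_G)
qed

section \<open>The group axioms\<close>

lemma add_closed:
  assumes "P \<in> carrier G" "Q \<in> carrier G" shows "ec_add R a P Q \<in> carrier G"
proof (cases P; cases Q)
  fix x1 y1 x2 y2 assume PQ: "P = Affine x1 y1" "Q = Affine x2 y2"
  show ?thesis
  proof (cases "p dvd x2 - x1 \<and> p dvd y2 + y1")
    case True
    with add_opposite[of x1 y1 x2 y2] assms PQ show ?thesis by simp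
  next
    case False
    with add_affine[of x1 y1 x2 y2] assms PQ show ?thesis by metis
  qed
qed (use assms in auto)

lemma add_commute:
  assumes "P \<in> carrier G" "Q \<in> carrier G" shows "ec_add R a P Q = ec_add R a Q P"
proof (cases P; cases Q)
  fix x1 y1 x2 y2 assume PQ: "P = Affine x1 y1" "Q = Affine x2 y2"
  show ?thesis
  proof (cases "p dvd x2 - x1 \<and> p dvd y2 + y1")
    case True
    then have "p dvd x1 - x2 \<and> p dvd y1 + y2" by (simp add: dvd_diff_commute add.commute)
    with True add_opposite[of x1 y1 x2 y2] add_opposite[of x2 y2 x1 y1] assms PQ
    show ?thesis by simp
  next
    case False
    obtain s t l c where *: "ec_add R a P Q = Affine s t"
      "Affine s t \<in> carrier G" "collinear x1 y1 x2 y2 s (- t) l c"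
      using add_affine[of x1 y1 x2 y2] False assms PQ by metis
    have "ec_add R a Q P = Affine s t"
      using add_affineI[OF _ _ *(2) collinear_swap[OF *(3)]] assms PQ by simp
    with * show ?thesis by simp
  qed
qed auto

text \<open>This is the degenerate case of associativity. Reflecting the line through
  \<open>Q\<close>, \<open>T\<close> and the opposite of their sum gives a line through
  \<open>- Q\<close>, which is the first summand, the sum itself and \<open>- T\<close>.\<close>

lemma add_neg_cancel:
  assumes P: "Affine x1 y1 \<in> carrier G" and Q: "Affine x2 y2 \<in> carrier G"
    and T: "T \<in> carrier G" and opp: "p dvd x2 - x1" "p dvd y2 + y1"
  shows "ec_add R a (Affine x1 y1) (ec_add R a (Affine x2 y2) T) = T"
proof (cases T)
  case Infinity
  with add_opposite[OF P Q opp] show ?thesis by simp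
next
  case (Affine x3 y3)
  note T' = T[unfolded this]
  have x: "x1 = x2" using P Q opp by (metis Affine_in_G eq_iff_dvd)
  show ?thesis
  proof (cases "p dvd x3 - x2 \<and> p dvd y3 + y2")
    case True
    then have "ec_add R a (Affine x2 y2) T = Infinity" using add_opposite[OF Q T'] Affine by simp
    moreover have "p dvd x1 - x3" using True x by (simp add: dvd_diff_commute)
    then have "x1 = x3" using P T' by (metis Affine_in_G eq_iff_dvd)
    moreover have "p dvd (y2 + y1) - (y3 + y2)" using opp True by (intro dvd_diff) auto
    then have "y1 = y3" using P T' by (simp add: Affine_in_G eq_iff_dvd)
    ultimately show ?thesis using Affine by simp
  next
    case False
    obtain s t l c where *: "ec_add R a (Affine x2 y2) T = Affine s t"
      "Affine s t \<in> carrier G" "collinear x2 y2 x3 y3 s (- t) l c"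
      using add_affine[OF Q T'] False Affine by metis
    have "collinear x2 (- y2) s t x3 (- y3) (- l) (- c)"
      using collinear_neg[OF *(3)[THEN collinear_rotate, THEN collinear_rotate, THEN collinear_swap]]
      by simp
    then have "collinear x1 y1 s t x3 (- y3) (- l) (- c)"
      using collinear_cong[of x2 "- y2" s t x3 "- y3" "- l" "- c" y1] x opp(2)
      by (simp add: add.commute)
    from add_affineI[OF P *(2) T' this] * Affine show ?thesis by simp
  qed
qed

lemma add_assoc:
  assumes "P \<in> carrier G" "Q \<in> carrier G" "T \<in> carrier G"
  shows "ec_add R a (ec_add R a P Q) T = ec_add R a P (ec_add R a Q T)"
proof (cases P; cases Q; cases T)
  fix x1 y1 x2 y2 x3 y3
  assume PQT: "P = Affine x1 y1" "Q = Affine x2 y2" "T = Affine x3 y3"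
  note P = assms(1)[unfolded PQT] and Q = assms(2)[unfolded PQT] and T = assms(3)[unfolded PQT]
  consider "p dvd x2 - x1 \<and> p dvd y2 + y1" | "p dvd x3 - x2 \<and> p dvd y3 + y2"
    | "\<not> (p dvd x2 - x1 \<and> p dvd y2 + y1)" "\<not> (p dvd x3 - x2 \<and> p dvd y3 + y2)" by blast
  then show ?thesis
  proof cases
    case 1
    then show ?thesis using add_opposite[OF P Q] add_neg_cancel[OF P Q assms(3)] PQT by simp
  next
    case 2
    then have "p dvd x2 - x3" "p dvd y2 + y3" by (simp_all add: dvd_diff_commute add.commute)
    then have "ec_add R a T (ec_add R a Q P) = P"
      using add_neg_cancel[OF T Q assms(1)] PQT by simp
    moreover have "ec_add R a (ec_add R a P Q) T = ec_add R a T (ec_add R a Q P)"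
      using add_commute add_closed assms by metis
    ultimately show ?thesis using 2 add_opposite[OF Q T] PQT by simp
  next
    case 3
    obtain s t l1 c1 where S: "ec_add R a P Q = Affine s t"
      "Affine s t \<in> carrier G" and PQ: "collinear x1 y1 x2 y2 s (- t) l1 c1"
      using add_affine[OF P Q] 3 PQT by metis
    obtain s' t' l3 c3 where S': "ec_add R a Q T = Affine s' t'"
      "Affine s' t' \<in> carrier G" and QT: "collinear x2 y2 x3 y3 s' (- t') l3 c3"
      using add_affine[OF Q T] 3 PQT by metis
    \<comment> \<open>Both sides say that the three given points lie on one line, so the two
      bracketings give \<open>Infinity\<close> simultaneously.\<close>
    have opp: "p dvd x3 - s \<and> p dvd y3 + t \<longleftrightarrow> p dvd s' - x1 \<and> p dvd t' + y1"
    proof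
      assume *: "p dvd x3 - s \<and> p dvd y3 + t"
      then have "x3 = s" using S(2) T by (simp add: Affine_in_G eq_iff_dvd)
      then have TPQ: "collinear x3 y3 x1 y1 x2 y2 l1 c1"
        using collinear_cong[OF PQ[THEN collinear_rotate, THEN collinear_rotate], of y3] * by simp
      show "p dvd s' - x1 \<and> p dvd t' + y1"
        using collinear_unique[OF TPQ[THEN collinear_rotate, THEN collinear_rotate] QT] 
        by (simp add: dvd_diff_commute add.commute)
    next
      assume *: "p dvd s' - x1 \<and> p dvd t' + y1"
      then have "s' = x1" using S'(2) P by (simp add: Affine_in_G eq_iff_dvd)
      then have QTP: "collinear x1 y1 x2 y2 x3 y3 l3 c3"
        using collinear_cong[OF QT[THEN collinear_rotate, THEN collinear_rotate], of y1] *
        by (simp add: add.commute)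
      show "p dvd x3 - s \<and> p dvd y3 + t"
        using collinear_unique[OF QTP PQ] by simp
    qed
    show ?thesis
    proof (cases "p dvd x3 - s \<and> p dvd y3 + t")
      case True
      then show ?thesis using opp add_opposite[OF S(2) T] add_opposite[OF P S'(2)] S S' PQT by simp
    next
      case False
      obtain u v l2 c2 where U: "ec_add R a (Affine s t) T = Affine u v"
        "Affine u v \<in> carrier G" and ST: "collinear s t x3 y3 u (- v) l2 c2"
        using add_affine[OF S(2) T] False PQT by metis
      obtain u' v' l4 c4 where U': "ec_add R a P (Affine s' t') = Affine u' v'"
        "Affine u' v' \<in> carrier G" and PS: "collinear x1 y1 s' t' u' (- v') l4 c4"
        using add_affine[OF P S'(2)] False opp PQT by metis
      show ?thesis
      proof (cases "p dvd x3 - x1 \<and> p dvd y3 - y1")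
        \<comment> \<open>For \<open>T = P\<close>, the case that \<open>collinear_assoc\<close>
          excludes, the two bracketings differ only by commutativity.\<close>
        case True
        then have "T = P" using P T PQT by (simp add: Affine_in_G eq_iff_dvd)
        then show ?thesis using add_commute add_closed assms by metis
      next
        case False
        have "p dvd u - u'" "p dvd v - v'"
          using collinear_assoc[OF PQ ST QT PS False] by auto
        then have "u = u'" "v = v'" using U U' by (simp_all add: Affine_in_G eq_iff_dvd)
        then show ?thesis using S S' U U' by simp
      qed
    qed
  qed
qed auto

theorem comm_group_G: "comm_group G"
proof (rule comm_groupI)
  fix P assume P: "P \<in> carrier G"
  show "\<exists>Q\<in>carrier G. Q \<otimes>\<^bsub>G\<^esub> P = \<one>\<^bsub>G\<^esub>"
  proof (cases P)
    case Infinity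
    then show ?thesis by (intro bexI[of _ Infinity]) auto
  next
    case (Affine x y)
    with P neg_mod_dvd[of y] add_opposite[OF neg_in_G, of x y x y] show ?thesis
      by (intro bexI[of _ "Affine x ((- y) mod p)"]) (auto intro: neg_in_G simp: add.commute)
  qed
next
  fix P Q T assume "P \<in> carrier G" "Q \<in> carrier G" "T \<in> carrier G"
  then show "P \<otimes>\<^bsub>G\<^esub> Q \<otimes>\<^bsub>G\<^esub> T = P \<otimes>\<^bsub>G\<^esub> (Q \<otimes>\<^bsub>G\<^esub> T)" by (simp add: add_assoc)
next
  fix P Q assume "P \<in> carrier G" "Q \<in> carrier G"
  then show "P \<otimes>\<^bsub>G\<^esub> Q = Q \<otimes>\<^bsub>G\<^esub> P" by (simp add: add_commute)
qed (simp_all add: add_closed)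

end

section \<open>Finite abelian groups with an action of the Gaussian integers\<close>

locale gaussian_group = comm_group G for G (structure) +
  fixes i :: "'a \<Rightarrow> 'a"
  assumes finite_G: "finite (carrier G)"
    and i_hom: "i \<in> hom G G"
    and i_i: "x \<in> carrier G \<Longrightarrow> i (i x) = inv x"
    and card_ker: "card {x \<in> carrier G. x \<otimes> i x = \<one>} = 2"
begin

section \<open>Multiplication by \<open>1 + i\<close> and the chain of kernels of its powers\<close>

definition f :: "'a \<Rightarrow> 'a" where "f x = x \<otimes> i x"

definition K :: "nat \<Rightarrow> 'a set" where "K j = {x \<in> carrier G. (f ^^ j) x = \<one>}"

lemma i_closed [simp]: "x \<in> carrier G \<Longrightarrow> i x \<in> carrier G"
  using i_hom by (auto simp: hom_def)

lemma i_mult: "x \<in> carrier G \<Longrightarrow> y \<in> carrier G \<Longrightarrow> i (x \<otimes> y) = i x \<otimes> i y"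
  using i_hom by (auto simp: hom_def)

lemma f_closed [simp]: "x \<in> carrier G \<Longrightarrow> f x \<in> carrier G"
  by (simp add: f_def)

lemma f_mult: "x \<in> carrier G \<Longrightarrow> y \<in> carrier G \<Longrightarrow> f (x \<otimes> y) = f x \<otimes> f y"
  by (simp add: f_def i_mult m_ac)

lemma f_pow_closed [simp]: "x \<in> carrier G \<Longrightarrow> (f ^^ j) x \<in> carrier G"
  by (induction j) auto

lemma f_pow_hom: "f ^^ j \<in> hom G G"
  by (rule homI) (simp, induction j, simp_all add: f_mult)

lemma f_pow_group_hom: "group_hom G G (f ^^ j)"
  by (rule group_hom.intro[OF is_group is_group group_hom_axioms.intro[OF f_pow_hom]])

text \<open>This is the identity \<open>(1 + i)\<^sup>2 = 2 i\<close>.\<close>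

lemma f_f: "x \<in> carrier G \<Longrightarrow> f (f x) = i x [^] (2::nat)"
proof -
  assume x: "x \<in> carrier G"
  have "f (f x) = (x \<otimes> i x) \<otimes> (i x \<otimes> inv x)"
    using x by (simp add: f_def i_mult i_i)
  also have "\<dots> = i x \<otimes> i x"
    using x by (simp add: m_assoc m_lcomm[of x "i x" "i x \<otimes> inv x"] m_lcomm[of x "i x" "inv x"])
  finally show ?thesis using x by (simp add: numeral_2_eq_2)
qed

lemma ker_unique:
  assumes "u \<in> carrier G" "f u = \<one>" "u \<noteq> \<one>" "v \<in> carrier G" "f v = \<one>" "v \<noteq> \<one>"
  shows "u = v"
proof (rule ccontr)
  assume "u \<noteq> v"
  then have "card {\<one>, u, v} = 3" using assms by auto
  moreover have "\<one> \<otimes> i \<one> = \<one>"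
    using i_mult[of \<one> \<one>] by simp
  then have "{\<one>, u, v} \<subseteq> {x \<in> carrier G. x \<otimes> i x = \<one>}"
    using assms by (auto simp: f_def)
  then have "card {\<one>, u, v} \<le> 2"
    using card_mono[of "{x \<in> carrier G. x \<otimes> i x = \<one>}"] finite_G card_ker by simp
  ultimately show False by simp
qed

lemma subgroup_K: "subgroup (K j) G"
  using group_hom.subgroup_kernel[OF f_pow_group_hom] by (simp add: K_def kernel_def)

text \<open>For \<open>x\<close> in \<open>K (Suc j)\<close> outside \<open>K j\<close>, the element
  \<open>(f ^^ j) x\<close> is the only nontrivial one in the kernel of \<open>f\<close>. Hence all
  such \<open>x\<close> form a single coset of \<open>K j\<close>.\<close>

lemma K_Suc:
  assumes w: "w \<in> K (Suc j)" "w \<notin> K j"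
  shows "K (Suc j) = K j \<union> (\<lambda>x. w \<otimes> x) ` K j"
proof -
  interpret h: group_hom G G "f ^^ j" by (rule f_pow_group_hom)
  have w': "w \<in> carrier G" "f ((f ^^ j) w) = \<one>" "(f ^^ j) w \<noteq> \<one>" using w by (auto simp: K_def)
  have f1: "f \<one> = \<one>" using group_hom.hom_one[OF f_pow_group_hom[of 1]] by simp
  show ?thesis
  proof (intro equalityI subsetI)
    fix x assume x: "x \<in> K (Suc j)"
    show "x \<in> K j \<union> (\<lambda>x. w \<otimes> x) ` K j"
    proof (cases "x \<in> K j")
      case False
      then have x': "x \<in> carrier G" "f ((f ^^ j) x) = \<one>" "(f ^^ j) x \<noteq> \<one>"
        using x by (simp_all add: K_def)
      have "(f ^^ j) x = (f ^^ j) w" using x' w' ker_unique[of "(f ^^ j) x" "(f ^^ j) w"] by simp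
      then have "inv w \<otimes> x \<in> K j" using x' w' by (simp add: K_def)
      moreover have "x = w \<otimes> (inv w \<otimes> x)" using x' w' by (simp flip: m_assoc)
      ultimately show ?thesis by blast
    qed simp
  next
    fix x assume "x \<in> K j \<union> (\<lambda>x. w \<otimes> x) ` K j"
    then show "x \<in> K (Suc j)" using w' f1 by (auto simp: K_def)
  qed
qed

text \<open>An element killed by \<open>n\<close> but not by \<open>n - 1\<close> applications of
  \<open>f\<close> supplies, through its images under \<open>f\<close>, a coset representative for
  \<open>K_Suc\<close> at every level below \<open>n\<close>.\<close>

lemma K_orbit:
  assumes P: "P \<in> carrier G" "(f ^^ n) P = \<one>" "(f ^^ (n - 1)) P \<noteq> \<one>" and j: "j < n"
  shows "(f ^^ (n - 1 - j)) P \<in> K (Suc j)" "(f ^^ (n - 1 - j)) P \<notin> K j"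
proof -
  have "f ^^ n = f ^^ (Suc j) \<circ> f ^^ (n - 1 - j)" "f ^^ (n - 1) = f ^^ j \<circ> f ^^ (n - 1 - j)"
    using j by (simp_all flip: funpow_add del: funpow.simps)
  with P show "(f ^^ (n - 1 - j)) P \<in> K (Suc j)" "(f ^^ (n - 1 - j)) P \<notin> K j"
    by (auto simp: K_def)
qed

lemma card_K:
  assumes P: "P \<in> carrier G" "(f ^^ n) P = \<one>" "(f ^^ (n - 1)) P \<noteq> \<one>" and j: "j \<le> n"
  shows "card (K j) = 2 ^ j"
  using j
proof (induction j)
  case 0
  have "K 0 = {\<one>}" by (auto simp: K_def)
  then show ?case by simp
next
  case (Suc j)
  define w where "w = (f ^^ (n - 1 - j)) P"
  have w: "w \<in> K (Suc j)" "w \<notin> K j" using K_orbit[OF P, of j] Suc by (auto simp: w_def)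
  have wc: "w \<in> carrier G" using P by (simp add: w_def)
  have sub: "K j \<subseteq> carrier G" by (auto simp: K_def)
  have fin: "finite (K j)" using sub finite_G finite_subset by blast
  have "inj_on (\<lambda>x. w \<otimes> x) (K j)" using sub wc by (auto simp: inj_on_def subset_iff)
  then have c: "card ((\<lambda>x. w \<otimes> x) ` K j) = card (K j)" by (rule card_image)
  have "K j \<inter> (\<lambda>x. w \<otimes> x) ` K j = {}"
  proof (rule ccontr)
    assume "K j \<inter> (\<lambda>x. w \<otimes> x) ` K j \<noteq> {}"
    then obtain x where x: "x \<in> K j" "w \<otimes> x \<in> K j" by auto
    then have "(w \<otimes> x) \<otimes> inv x \<in> K j"
      using subgroup.m_closed[OF subgroup_K] subgroup.m_inv_closed[OF subgroup_K] by blast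
    then show False using w(2) x sub wc by (simp add: m_assoc subset_iff)
  qed
  with K_Suc[OF w] c fin Suc show ?case by (simp add: card_Un_disjoint)
qed

lemma i_pow: "x \<in> carrier G \<Longrightarrow> i (x [^] (n::nat)) = i x [^] n"
  using group_hom.hom_nat_pow[OF group_hom.intro[OF is_group is_group group_hom_axioms.intro[OF i_hom]]] .

text \<open>Up to a power of the unit \<open>i\<close>, the \<open>2 * j\<close>-th power of
  \<open>1 + i\<close> is \<open>2 ^ j\<close>.\<close>

lemma f_pow_2_eq_one_iff:
  assumes "x \<in> carrier G" shows "(f ^^ (2 * j)) x = \<one> \<longleftrightarrow> x [^] (2 ^ j :: nat) = \<one>"
  using assms
proof (induction j arbitrary: x)
  case (Suc j)
  have i_one: "i \<one> = \<one>" using i_pow[of \<one> 0] by simp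
  have "(f ^^ (2 * Suc j)) x = (f ^^ (2 * j)) (f (f x))"
    by (simp add: funpow_swap1)
  then have "(f ^^ (2 * Suc j)) x = \<one> \<longleftrightarrow> (f (f x)) [^] (2 ^ j :: nat) = \<one>"
    using Suc by simp
  also have "(f (f x)) [^] (2 ^ j :: nat) = i (x [^] (2 ^ Suc j :: nat))"
    using Suc.prems by (simp add: f_f nat_pow_pow i_pow)
  also have "\<dots> = \<one> \<longleftrightarrow> x [^] (2 ^ Suc j :: nat) = \<one>"
    using i_i[of "x [^] (2 ^ Suc j :: nat)"] i_one Suc.prems
    by (metis inv_eq_1_iff nat_pow_closed)
  finally show ?case .
qed simp

text \<open>Let \<open>n\<close> be the least exponent for which \<open>f ^^ n\<close> kills the
  group. Some \<open>P\<close> survives \<open>n - 1\<close> applications, so \<open>K n\<close>,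
  which is the whole group, has \<open>2 ^ n\<close> elements, and \<open>n = N\<close>.\<close>

lemma obtain_generator:
  assumes ord: "order G = 2 ^ N" and N: "N > 0"
  obtains P where "P \<in> carrier G" "(f ^^ (N - 1)) P \<noteq> \<one>" "\<And>x. x \<in> carrier G \<Longrightarrow> (f ^^ N) x = \<one>"
proof -
  let ?A = "\<lambda>n. \<forall>x \<in> carrier G. (f ^^ n) x = \<one>"
  define n where "n = (LEAST n. ?A n)"
  have "?A (2 * N)" using f_pow_2_eq_one_iff pow_order_eq_1 ord by simp
  then have n: "?A n" unfolding n_def by (rule LeastI)
  have "n > 0"
  proof (rule ccontr)
    assume "\<not> n > 0"
    then have "carrier G = {\<one>}" using n by auto
    then have "order G = 1" by (simp add: order_def)
    with ord N show False by (cases N) auto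
  qed
  then have "\<not> ?A (n - 1)" using not_less_Least[of "n - 1" ?A] unfolding n_def[symmetric] by simp
  then obtain P where P: "P \<in> carrier G" "(f ^^ (n - 1)) P \<noteq> \<one>" by blast
  have "K n = carrier G" using n by (auto simp: K_def)
  then have "2 ^ n = (2 ^ N :: nat)" using card_K[of P n n] P n ord by (simp add: order_def)
  then have "n = N" by simp
  with P n that show ?thesis by blast
qed

section \<open>Decomposition into two cyclic groups\<close>

lemma int_pow_mod:
  assumes "x \<in> carrier G" "x [^] (n::nat) = \<one>" shows "x [^] (c mod int n) = x [^] (c::int)"
proof -
  have "x [^] c = x [^] (int n * (c div int n) + c mod int n)" by simp
  also have "\<dots> = (x [^] int n) [^] (c div int n) \<otimes> x [^] (c mod int n)"
    by (simp only: int_pow_mult[OF assms(1)] int_pow_pow[OF assms(1)])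
  also have "x [^] int n = \<one>" using assms(2) by (simp only: int_pow_int)
  finally show ?thesis using assms(1) by simp
qed

text \<open>A generator \<open>P\<close> over the Gaussian integers and \<open>Q = f P\<close>
  generate the group as an abelian group, because 1 and \<open>1 + i\<close> form a basis of these
  integers. The orders of \<open>P\<close> and \<open>Q\<close> divide \<open>2 ^ (k + 1)\<close>
  and \<open>2 ^ k\<close>, and counting shows that there are no further relations.\<close>

theorem iso_prod:
  assumes ord: "order G = 2 ^ (2 * k + 1)"
  shows "G \<cong> integer_mod_group (2 ^ k) \<times>\<times> integer_mod_group (2 ^ (k + 1))"
proof -
  let ?Z = "integer_mod_group (2 ^ k) \<times>\<times> integer_mod_group (2 ^ (k + 1))"
  obtain P where P: "P \<in> carrier G" "(f ^^ (2 * k)) P \<noteq> \<one>"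
    and nil: "\<And>x. x \<in> carrier G \<Longrightarrow> (f ^^ (2 * k + 1)) x = \<one>"
    using obtain_generator[OF ord] by auto
  define Q where "Q = f P"
  have Q: "Q \<in> carrier G" using P by (simp add: Q_def)
  \<comment> \<open>Powers of 2 correspond to even powers of \<open>1 + i\<close>. For
    \<open>P\<close> the exponent \<open>2 * k + 1\<close> is rounded up to
    \<open>2 * k + 2\<close>; \<open>Q\<close> already contains one factor, so \<open>2 * k\<close>
    suffices.\<close>
  have P_ord: "P [^] (2 ^ (k + 1) :: nat) = \<one>"
  proof -
    have "(f ^^ (2 * (k + 1))) P = (f ^^ (2 * k + 1)) (f P)"
      by (simp add: funpow_swap1)
    then show ?thesis using f_pow_2_eq_one_iff[of P "k + 1"] nil[of "f P"] P by simp
  qed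
  have Q_ord: "Q [^] (2 ^ k :: nat) = \<one>"
  proof -
    have "(f ^^ (2 * k)) Q = (f ^^ (2 * k + 1)) P" by (simp add: Q_def funpow_swap1)
    then show ?thesis using f_pow_2_eq_one_iff[of Q k] nil[of P] P Q by simp
  qed
  define h :: "int \<times> int \<Rightarrow> 'a" where "h = (\<lambda>(u, v). Q [^] u \<otimes> P [^] v)"
  have h_mult: "h (u + u', v + v') = h (u, v) \<otimes> h (u', v')" for u v u' v'
    using P Q by (simp add: h_def int_pow_mult m_ac)
  have h_mod: "h (u mod 2 ^ k, v mod 2 ^ (k + 1)) = h (u, v)" for u v
    using int_pow_mod[OF P(1) P_ord, of v] int_pow_mod[OF Q Q_ord, of u] by (simp add: h_def)
  interpret f: group_hom G G f using f_pow_group_hom[of 1] by simp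
  \<comment> \<open>In the Gaussian integers,
    \<open>(1 + i)\<^sup>2 = 2 (1 + i) - 2\<close>.\<close>
  have fQ: "f Q = Q [^] (2::int) \<otimes> P [^] (- 2 :: int)"
  proof -
    have "i P = Q \<otimes> inv P" using P by (simp add: Q_def f_def m_comm m_assoc[symmetric])
    then have "f Q = (Q \<otimes> inv P) [^] (2::int)"
      using f_f[OF P(1)] by (simp add: Q_def int_pow_int[of G _ 2, simplified])
    then show ?thesis using P Q by (simp add: int_pow_distrib int_pow_neg int_pow_inv)
  qed
  have f_range: "f x \<in> range h" if x: "x \<in> range h" for x
  proof -
    obtain u v where "x = Q [^] (u::int) \<otimes> P [^] (v::int)" using x by (auto simp: h_def)
    then have "f x = (f Q) [^] u \<otimes> Q [^] v" using P Q by (simp add: f.hom_int_pow Q_def)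
    also have "\<dots> = h (2 * u + v, - 2 * u)"
      using P Q by (simp add: fQ h_def int_pow_distrib int_pow_pow int_pow_mult m_ac)
    finally show ?thesis by blast
  qed
  have fj_range: "(f ^^ j) P \<in> range h" for j
  proof (induction j)
    case 0
    have "P = h (0, 1)" using P Q by (simp add: h_def)
    then show ?case by auto
  qed (simp add: f_range)
  \<comment> \<open>The range of \<open>h\<close> contains the images of \<open>P\<close> under
    powers of \<open>f\<close>, which are the coset representatives of all levels, so it exhausts
    the chain of kernels.\<close>
  have K_range: "j \<le> 2 * k + 1 \<Longrightarrow> K j \<subseteq> range h" for j
  proof (induction j)
    case 0
    have "\<one> = h (0, 0)" using P Q by (simp add: h_def)
    then show ?case by (auto simp: K_def)
  next
    case (Suc j)
    let ?w = "(f ^^ (2 * k + 1 - 1 - j)) P"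
    have *: "K (Suc j) = K j \<union> (\<lambda>x. ?w \<otimes> x) ` K j"
      using K_orbit[of P "2 * k + 1" j] P nil Suc.prems by (intro K_Suc) auto
    obtain u v where w: "?w = h (u, v)" using fj_range by (metis imageE old.prod.exhaust)
    have "?w \<otimes> x \<in> range h" if x: "x \<in> range h" for x
    proof -
      obtain u' v' where "x = h (u', v')" using x by auto
      then show ?thesis using h_mult w by (metis rangeI)
    qed
    then show ?case using * Suc by auto
  qed
  have h_closed: "h z \<in> carrier G" for z using P Q by (auto simp: h_def split: prod.split)
  have surj: "h ` carrier ?Z = carrier G"
  proof (intro equalityI subsetI)
    fix x assume "x \<in> carrier G"
    then have "x \<in> K (2 * k + 1)" using nil by (simp add: K_def del: funpow.simps)
    then obtain u v where "x = h (u, v)" using K_range[of "2 * k + 1"] by auto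
    then have "x = h (u mod 2 ^ k, v mod 2 ^ (k + 1))" using h_mod by simp
    then show "x \<in> h ` carrier ?Z" by (intro image_eqI) (auto simp: carrier_integer_mod_group)
  qed (use h_closed in auto)
  have hom: "h \<in> hom ?Z G"
  proof (rule homI)
    fix x y assume "x \<in> carrier ?Z" "y \<in> carrier ?Z"
    obtain u v u' v' where xy: "x = (u, v)" "y = (u', v')" by fastforce
    have "x \<otimes>\<^bsub>?Z\<^esub> y = ((u + u') mod 2 ^ k, (v + v') mod 2 ^ (k + 1))" by (simp add: xy)
    then show "h (x \<otimes>\<^bsub>?Z\<^esub> y) = h x \<otimes> h y" by (simp only: xy h_mod h_mult)
  qed (rule h_closed)
  have "carrier ?Z = {0..<2 ^ k} \<times> {0..<2 ^ (k + 1)}" by (simp add: carrier_integer_mod_group)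
  then have "card (carrier ?Z) = nat (2 ^ k) * nat (2 ^ (k + 1))"
    by (simp only: card_cartesian_product card_atLeastLessThan_int diff_zero)
  also have "\<dots> = 2 ^ k * 2 ^ (k + 1)"
    by (simp only: nat_power_eq[OF zero_le_numeral] nat_numeral)
  also have "\<dots> = 2 ^ (k + (k + 1))" by (rule power_add[symmetric])
  also have "k + (k + 1) = 2 * k + 1" by simp
  also have "2 ^ (2 * k + 1) = order G" by (rule ord[symmetric])
  finally have "card (carrier ?Z) = order G" .
  then have "inj_on h (carrier ?Z)"
    using surj by (intro eq_card_imp_inj_on) (simp_all add: order_def carrier_integer_mod_group)
  with hom surj have "h \<in> iso ?Z G" by (simp add: iso_def bij_betw_def)
  then have "?Z \<cong> G" by (auto simp: is_iso_def)
  moreover have "group ?Z" by (simp add: DirProd_group)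
  ultimately show ?thesis using group.iso_sym by blast
qed

end

section \<open>The curves with multiplication by a square root of \<open>-1\<close>\<close>

context weierstrass_mod
begin

lemma card_G: "int (order G) = p + 1 + (\<Sum>x\<in>{0..<p}. chi (x ^ 3 + a * x + b))"
proof -
  let ?Y = "\<lambda>x. {y \<in> {0..<p}. p dvd y\<^sup>2 - (x ^ 3 + a * x + b)}"
  have fin: "finite (?Y x)" for x by (rule finite_subset[of _ "{0..<p}"]) auto
  let ?X = "SIGMA x:{0..<p}. ?Y x" and ?g = "\<lambda>(x, y). Affine x y"
  have "carrier G = insert Infinity (?g ` ?X)"
  proof (rule Set.set_eqI)
    fix P show "P \<in> carrier G \<longleftrightarrow> P \<in> insert Infinity (?g ` ?X)"
      by (cases P) (auto simp: Affine_in_G)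
  qed
  then have "order G = card (insert Infinity (?g ` ?X))" by (simp only: order_def)
  also have "\<dots> = Suc (card (?g ` ?X))"
    using fin by (intro card_insert_disjoint finite_imageI finite_SigmaI) auto
  also have "card (?g ` ?X) = card ?X" by (rule card_image) (auto simp: inj_on_def)
  also have "card (SIGMA x:{0..<p}. ?Y x) = (\<Sum>x\<in>{0..<p}. card (?Y x))"
    using fin by simp
  finally have "int (order G) = 1 + (\<Sum>x\<in>{0..<p}. int (card (?Y x)))" by simp
  also have "\<dots> = 1 + (\<Sum>x\<in>{0..<p}. 1 + chi (x ^ 3 + a * x + b))"
    by (simp only: card_square_roots)
  finally show ?thesis using p_gt_2 by (simp add: sum.distrib)
qed

end

section \<open>The action of a square root of \<open>- 1\<close> on the curve\<close>

locale gaussian_curve = odd_prime p for p +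
  fixes a c I :: int
  assumes I: "p dvd I\<^sup>2 + 1" and c: "\<not> p dvd c" and a: "p dvd a + c ^ 4"

sublocale gaussian_curve \<subseteq> weierstrass_mod p a 0
proof
  fix x assume x: "p dvd x ^ 3 + a * x + 0"
  show "\<not> p dvd 3 * x\<^sup>2 + a"
  proof
    assume d: "p dvd 3 * x\<^sup>2 + a"
    from x d have "p dvd 2 * x ^ 3" by Groebner_Basis.algebra
    then have "p dvd x" using double_dvd prime prime_dvd_power by blast
    with d a have "p dvd c ^ 4" by Groebner_Basis.algebra
    with c prime prime_dvd_power show False by blast
  qed
qed

context gaussian_curve
begin

fun rot :: "int ec_point \<Rightarrow> int ec_point" where
  "rot Infinity = Infinity"
| "rot (Affine x y) = Affine ((- x) mod p) ((I * y) mod p)"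

text \<open>Substituting \<open>- x'\<close> for \<open>x\<close> in
  \<open>y' = I * (l * x + d)\<close> gives the new slope and intercept. Coordinates matter only up
  to congruence, so the reduced values in \<open>rot\<close> are admissible.\<close>

lemma collinear_rot:
  assumes col: "collinear x1 y1 x2 y2 x3 y3 l d"
    and x: "p dvd x1' + x1" "p dvd x2' + x2" "p dvd x3' + x3"
    and y: "p dvd y1' - I * y1" "p dvd y2' - I * y2" "p dvd y3' - I * y3"
  shows "collinear x1' y1' x2' y2' x3' y3' (- I * l) (I * d)"
proof -
  have col': "p dvd y1 - (l * x1 + d)" "p dvd y2 - (l * x2 + d)" "p dvd y3 - (l * x3 + d)"
    "p dvd l\<^sup>2 - (x1 + x2 + x3)" "p dvd a - 2 * l * d - (x1 * x2 + x1 * x3 + x2 * x3)"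
    "p dvd - d\<^sup>2 + x1 * x2 * x3"
    using col by (auto simp: collinear_def)
  have line: "p dvd v' - (- I * l * u' + I * d)"
    if "p dvd v - (l * u + d)" "p dvd u' + u" "p dvd v' - I * v" for u v u' v'
    using that by Groebner_Basis.algebra
  have "p dvd (- I * l)\<^sup>2 - (x1' + x2' + x3')"
    using col'(4) x I by Groebner_Basis.algebra
  moreover have "p dvd a - 2 * (- I * l) * (I * d) - (x1' * x2' + x1' * x3' + x2' * x3')"
    using col'(5) x I by Groebner_Basis.algebra
  moreover have "p dvd - (I * d)\<^sup>2 + x1' * x2' * x3'"
    using col'(6) x I by Groebner_Basis.algebra
  ultimately show ?thesis
    unfolding collinear_def diff_0
    using line[OF col'(1) x(1) y(1)] line[OF col'(2) x(2) y(2)] line[OF col'(3) x(3) y(3)] by blast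
qed

lemma rot_coords:
  "p dvd (- x) mod p + x" "p dvd (I * y) mod p - I * y"
  by (rule neg_mod_dvd) simp

lemma rot_in_G: "P \<in> carrier G \<Longrightarrow> rot P \<in> carrier G"
proof (cases P)
  case (Affine x y)
  assume "P \<in> carrier G"
  with Affine have P: "p dvd y\<^sup>2 - (x ^ 3 + a * x + 0)" by (simp add: Affine_in_G)
  have "p dvd y'\<^sup>2 - (x' ^ 3 + a * x' + 0)" if "p dvd x' + x" "p dvd y' - I * y" for x' y'
    using that P I by Groebner_Basis.algebra
  from this[OF rot_coords] show ?thesis using p_gt_2 Affine by (simp add: Affine_in_G)
qed simp

lemma rot_hom: "rot \<in> hom G G"
proof (rule homI)
  fix P Q assume PQ: "P \<in> carrier G" "Q \<in> carrier G"
  show "rot (P \<otimes>\<^bsub>G\<^esub> Q) = rot P \<otimes>\<^bsub>G\<^esub> rot Q"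
  proof (cases P; cases Q)
    fix x1 y1 x2 y2 assume eq: "P = Affine x1 y1" "Q = Affine x2 y2"
    let ?x1 = "(- x1) mod p" and ?y1 = "(I * y1) mod p" and ?x2 = "(- x2) mod p" and ?y2 = "(I * y2) mod p"
    have in_G: "Affine ?x1 ?y1 \<in> carrier G" "Affine ?x2 ?y2 \<in> carrier G"
      using rot_in_G[OF PQ(1)] rot_in_G[OF PQ(2)] eq by simp_all
    show ?thesis
    proof (cases "p dvd x2 - x1 \<and> p dvd y2 + y1")
      case True
      have "p dvd x2' - x1' \<and> p dvd y2' + y1'"
        if "p dvd x1' + x1" "p dvd y1' - I * y1" "p dvd x2' + x2" "p dvd y2' - I * y2" for x1' y1' x2' y2'
        using that True by (elim conjE, intro conjI; Groebner_Basis.algebra)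
      from this[OF rot_coords rot_coords] show ?thesis
        using True add_opposite[of x1 y1 x2 y2] add_opposite[OF in_G] PQ eq by simp
    next
      case False
      obtain s t l d where S: "ec_add R a P Q = Affine s t"
        "Affine s t \<in> carrier G" "collinear x1 y1 x2 y2 s (- t) l d"
        using add_affine[of x1 y1 x2 y2] False PQ eq by metis
      have "p dvd - ((I * t) mod p) - I * (- t)"
        using rot_coords(2)[of t] by Groebner_Basis.algebra
      from collinear_rot[OF S(3) rot_coords(1) rot_coords(1) rot_coords(1) rot_coords(2) rot_coords(2) this]
      have "collinear ?x1 ?y1 ?x2 ?y2 ((- s) mod p) (- ((I * t) mod p)) (- I * l) (I * d)" .
      from add_affineI[OF in_G _ this] rot_in_G[OF S(2)] S(1) eq show ?thesis by simp
    qed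
  qed auto
qed (rule rot_in_G)

lemma rot_rot: "P \<in> carrier G \<Longrightarrow> rot (rot P) = inv\<^bsub>G\<^esub> P"
proof -
  interpret group G using comm_group_G by (rule comm_group.axioms(2))
  assume P: "P \<in> carrier G"
  have "ec_add R a (rot (rot P)) P = Infinity"
  proof (cases P)
    case (Affine x y)
    have "p dvd x - x'' \<and> p dvd y + y''"
      if "p dvd x' + x" "p dvd y' - I * y" "p dvd x'' + x'" "p dvd y'' - I * y'" for x' y' x'' y''
      using that I by (intro conjI; Groebner_Basis.algebra)
    from this[OF rot_coords rot_coords] show ?thesis
      using add_opposite rot_in_G[OF rot_in_G[OF P]] P Affine by simp
  qed simp
  then show ?thesis using inv_equality[of "rot (rot P)" P] rot_in_G P by simp
qed

lemma origin_in_G: "Affine 0 0 \<in> carrier G"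
  using p_gt_2 by (simp add: Affine_in_G)

text \<open>This is the kernel of \<open>1 + i\<close>: if \<open>P\<close> and \<open>rot P\<close>
  are opposite, then \<open>x\<close> is congruent to \<open>- x\<close>, which forces
  \<open>x = 0\<close> and then \<open>y = 0\<close>.\<close>

lemma fixed_points: "{P \<in> carrier G. ec_add R a P (rot P) = Infinity} = {Infinity, Affine 0 0}"
proof (intro equalityI subsetI)
  fix P assume "P \<in> {P \<in> carrier G. ec_add R a P (rot P) = Infinity}"
  then have P: "P \<in> carrier G" "ec_add R a P (rot P) = Infinity" by auto
  show "P \<in> {Infinity, Affine 0 0}"
  proof (cases P)
    case (Affine x y)
    have in_G: "Affine x y \<in> carrier G" "Affine ((- x) mod p) ((I * y) mod p) \<in> carrier G"
      using P(1) rot_in_G[OF P(1)] Affine by simp_all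
    have "p dvd (- x) mod p - x"
      using add_affine[OF in_G] P(2) Affine by (metis ec_point.distinct(1) rot.simps(2))
    with rot_coords(1)[of x] have "p dvd 2 * x" by Groebner_Basis.algebra
    then have x: "p dvd x" by (rule double_dvd)
    then have x0: "x = 0" using in_G(1) p_gt_2 eq_iff_dvd[of x 0] by (simp add: Affine_in_G)
    then have "p dvd y\<^sup>2" using in_G(1) by (simp add: Affine_in_G)
    then have "p dvd y" using prime prime_dvd_power by blast
    then have "y = 0" using in_G(1) p_gt_2 eq_iff_dvd[of y 0] by (simp add: Affine_in_G)
    with x0 Affine show ?thesis by simp
  qed simp
next
  fix P :: "int ec_point" assume "P \<in> {Infinity, Affine 0 0}"
  then show "P \<in> {P \<in> carrier G. ec_add R a P (rot P) = Infinity}"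
    using origin_in_G add_opposite[OF origin_in_G origin_in_G] by auto
qed

text \<open>An infinite carrier would have \<open>order\<close> 0, whereas \<open>card_G\<close> and
  \<open>chi \<ge> - 1\<close> bound the order below by \<open>p + 1 - p\<close>.\<close>

lemma finite_G: "finite (carrier G)"
proof -
  have "order G > 0"
  proof (rule ccontr)
    assume "\<not> order G > 0"
    then have "\<not> (0::int) < p + 1 + (\<Sum>x\<in>{0..<p}. chi (x ^ 3 + a * x + 0))" using card_G by simp
    moreover have "(\<Sum>x\<in>{0..<p}. chi (x ^ 3 + a * x + 0)) \<ge> (\<Sum>x\<in>{0..<p}. - 1)"
    proof (rule sum_mono)
      fix x show "- 1 \<le> chi (x ^ 3 + a * x + 0)" using chi_values[of "x ^ 3 + a * x + 0"] by auto
    qed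
    ultimately show False using p_gt_2 by simp
  qed
  then show ?thesis by (simp add: order_def card_gt_0_iff)
qed

lemma gaussian_group_G: "gaussian_group G rot"
proof (rule gaussian_group.intro[OF comm_group_G], unfold_locales)
  show "card {P \<in> carrier G. P \<otimes>\<^bsub>G\<^esub> rot P = \<one>\<^bsub>G\<^esub>} = 2" by (simp add: fixed_points)
qed (simp_all add: finite_G rot_hom rot_rot)

section \<open>The order of the group\<close>

lemma eight_dvd_order: "8 dvd order G"
proof -
  interpret g: gaussian_group G rot by (rule gaussian_group_G)
  \<comment> \<open>Modulo \<open>p\<close>, multiplication by \<open>1 + i\<close> takes this point
    to \<open>(c\<^sup>2, 0)\<close>, then to \<open>(0, 0)\<close>, then to
    \<open>Infinity\<close>. Hence \<open>K 3\<close> is a subgroup with 8 elements.\<close>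
  define x where "x = (c\<^sup>2 * I) mod p"
  define y where "y = (c ^ 3 * (1 - I)) mod p"
  define s where "s = c\<^sup>2 mod p"
  have x: "p dvd x - c\<^sup>2 * I" and y: "p dvd y - c ^ 3 * (1 - I)" and s: "p dvd s - c\<^sup>2"
    by (simp_all add: x_def y_def s_def)
  have "p dvd y\<^sup>2 - (c ^ 3 * (1 - I))\<^sup>2" "p dvd x ^ 3 - (c\<^sup>2 * I) ^ 3"
    using x y by Groebner_Basis.algebra+
  moreover have "p dvd a * x + c ^ 4 * (c\<^sup>2 * I)" using x a by Groebner_Basis.algebra
  moreover have "p dvd (c ^ 3 * (1 - I))\<^sup>2 - (c\<^sup>2 * I) ^ 3 + c ^ 4 * (c\<^sup>2 * I)"
    using I by Groebner_Basis.algebra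
  ultimately have "p dvd y\<^sup>2 - (x ^ 3 + a * x)" by Groebner_Basis.algebra
  then have P: "Affine x y \<in> carrier G" using p_gt_2 by (simp add: Affine_in_G x_def y_def)
  have "p dvd z\<^sup>2 - (s ^ 3 + a * s)" if "p dvd z" for z using that s a by Groebner_Basis.algebra
  from this[OF dvd_0_right] have Q: "Affine s 0 \<in> carrier G"
    using p_gt_2 by (simp add: Affine_in_G s_def)
  \<comment> \<open>The line \<open>y = - c x + c ^ 3\<close> passes through
    \<open>(c\<^sup>2 I, c ^ 3 (1 - I))\<close>, its image
    \<open>(- c\<^sup>2 I, c ^ 3 (1 + I))\<close> and \<open>(c\<^sup>2, 0)\<close>.\<close>
  have "collinear x y x' y' s z (- c) (c ^ 3)" if *: "p dvd x' + x" "p dvd y' - I * y" "p dvd z" for x' y' z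
  proof -
    have "y' - (- c * x' + c ^ 3) = (y' - I * y) + I * (y - c ^ 3 * (1 - I)) + c * (x' + x)
        - (c * (x - c\<^sup>2 * I) + c ^ 3 * (I\<^sup>2 + 1))"
      by Groebner_Basis.algebra
    then have "p dvd y' - (- c * x' + c ^ 3)"
      using x y I * by (simp only: dvd_add dvd_diff dvd_mult)
    moreover have "p dvd y - (- c * x + c ^ 3)" using x y by Groebner_Basis.algebra
    moreover have "p dvd z - (- c * s + c ^ 3)" using *(3) s by Groebner_Basis.algebra
    moreover have "p dvd (- c)\<^sup>2 - (x + x' + s)" using *(1) s by Groebner_Basis.algebra
    moreover have "p dvd a - 2 * (- c) * c ^ 3 - (x * x' + x * s + x' * s)"
      using a I x s *(1) by Groebner_Basis.algebra
    moreover have "p dvd - (c ^ 3)\<^sup>2 + x * x' * s" using I x s *(1) by Groebner_Basis.algebra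
    ultimately show ?thesis unfolding collinear_def diff_0 by blast
  qed
  from add_affineI[OF P _ Q this[OF rot_coords dvd_0_right]] rot_in_G[OF P]
  have fP: "g.f (Affine x y) = Affine s 0" by (simp add: g.f_def)
  \<comment> \<open>This line is the horizontal axis, which meets the curve at
    \<open>c\<^sup>2\<close>, \<open>- c\<^sup>2\<close> and 0.\<close>
  have "collinear s 0 s' 0 0 0 0 0" if *: "p dvd s' + s" for s'
  proof -
    have "p dvd a - s * s'" using * s a by Groebner_Basis.algebra
    moreover have "p dvd - (s' + s)" using * by (simp only: dvd_minus_iff)
    ultimately show ?thesis by (simp add: collinear_def algebra_simps)
  qed
  from add_affineI[OF Q _ origin_in_G this[OF rot_coords(1)]] rot_in_G[OF Q]
  have fQ: "g.f (Affine s 0) = Affine 0 0" by (simp add: g.f_def)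
  have "Affine 0 0 \<in> {P \<in> carrier G. ec_add R a P (rot P) = Infinity}"
    unfolding fixed_points by simp
  then have f0: "g.f (Affine 0 0) = Infinity" by (simp add: g.f_def)
  have "(g.f ^^ 3) (Affine x y) = \<one>\<^bsub>G\<^esub>" "(g.f ^^ (3 - 1)) (Affine x y) \<noteq> \<one>\<^bsub>G\<^esub>"
    by (simp_all add: numeral_eq_Suc fP fQ f0)
  from g.card_K[OF P this order.refl] have "card (g.K 3) = 8" by simp
  moreover have "card (g.K 3) dvd order G"
    using g.lagrange[OF g.subgroup_K[of 3]] by (metis dvd_triv_right)
  ultimately show ?thesis by simp
qed

text \<open>The factor \<open>c ^ 4\<close> is the square of \<open>c\<^sup>2\<close>, whose
  character is 1, so scaling it away leaves even the sign of \<open>S 1\<close> unchanged.\<close>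

lemma order_G: "int (order G) = p + 1 + S 1"
proof -
  have "chi (x ^ 3 + a * x + 0) = chi x * chi (x\<^sup>2 - 1 * (c\<^sup>2)\<^sup>2)" for x
  proof -
    have "p dvd (x ^ 3 + a * x + 0) - x * (x\<^sup>2 - 1 * (c\<^sup>2)\<^sup>2)" using a by Groebner_Basis.algebra
    from chi_cong[OF this] show ?thesis by (simp only: chi_mult)
  qed
  then have "int (order G) = p + 1 + S (1 * (c\<^sup>2)\<^sup>2)" using card_G by (simp only: S_def)
  moreover have "\<not> p dvd c\<^sup>2" using c prime prime_dvd_power by blast
  then have "S (1 * (c\<^sup>2)\<^sup>2) = chi (c\<^sup>2) * S 1" by (rule S_mult_square)
  ultimately show ?thesis using chi_square[OF c] by simp
qed

lemma order_sum_of_squares: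
  obtains A B where "A\<^sup>2 + B\<^sup>2 = p" "int (order G) = p + 1 + 2 * A"
proof -
  have "chi (- 1) = 1" using I p_gt_2 by (auto simp: chi_eq_1_iff)
  moreover obtain r where "chi r = - 1" by (rule ex_nonresidue)
  ultimately have J: "(S 1)\<^sup>2 + (S r)\<^sup>2 = 4 * p" by (rule jacobsthal)
  \<comment> \<open>The order is even and \<open>p\<close> is odd, which settles \<open>S 1\<close>;
    since the squares add up to \<open>4 * p\<close>, the parity of \<open>S r\<close>
    follows.\<close>
  have "even (S 1)"
  proof -
    have "odd p" using prime prime_odd_int p_gt_2 by blast
    moreover have "even (p + 1 + S 1)" using eight_dvd_order unfolding order_G[symmetric] by presburger
    ultimately show ?thesis by simp
  qed
  moreover have "even (S r)"
  proof -
    have "even ((S 1)\<^sup>2 + (S r)\<^sup>2)" using J by simp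
    with \<open>even (S 1)\<close> show ?thesis by simp
  qed
  ultimately obtain A B where AB: "S 1 = 2 * A" "S r = 2 * B" by (elim evenE)
  with J have "A\<^sup>2 + B\<^sup>2 = p" by (simp add: power_mult_distrib)
  with that order_G AB show ?thesis by simp
qed

end

section \<open>The primes \<open>H k\<close>\<close>

lemma H_sum_of_squares: "H k = (2 ^ k)\<^sup>2 + (2 ^ k - 1)\<^sup>2"
proof -
  have "(2::int) ^ (2 * k + 1) = 2 * (2 ^ k)\<^sup>2" by (simp add: power_even_eq)
  then show ?thesis unfolding H_def by (simp add: power2_eq_square algebra_simps)
qed

theorem theorem2p8:
  fixes k :: nat and m :: int
  assumes "k \<ge> 1"
    and "prime (H k)"
    and "\<not> [m = 0] (mod H k)"
    and "\<exists>a::int. [m = a ^ 4] (mod H k)"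
  shows "ec_group (residue_ring (H k)) ((- m) mod H k) 0
           \<cong> integer_mod_group (2 ^ k) \<times>\<times> integer_mod_group (2 ^ (k + 1))"
proof -
  let ?p = "H k"
  define t :: int where "t = 2 ^ k"
  obtain j where "k = Suc j" using assms(1) by (metis Suc_le_D One_nat_def)
  then have "t = 2 * 2 ^ j" by (simp add: t_def)
  then have t: "even t" "t \<ge> 2" by simp_all
  have p: "?p = t\<^sup>2 + (t - 1)\<^sup>2" by (simp add: H_sum_of_squares t_def)
  obtain c where c: "[m = c ^ 4] (mod ?p)" using assms(4) by blast
  have "t * 1 \<le> t * t" using t by (intro mult_left_mono) auto
  then have "t \<le> t\<^sup>2" by (simp add: power2_eq_square)
  moreover have "0 \<le> (t - 1)\<^sup>2" by simp
  ultimately have "0 < t - 1" "t - 1 < ?p" using t p by linarith+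
  then have "coprime (t - 1) ?p"
    using assms(2) by (metis coprime_commute prime_imp_coprime zdvd_not_zless)
  then obtain w where w: "[(t - 1) * w = 1] (mod ?p)" by (metis cong_solve_coprime_int)
  \<comment> \<open>As \<open>w\<close> inverts \<open>t - 1\<close> and \<open>t\<^sup>2\<close> is
    congruent to \<open>- (t - 1)\<^sup>2\<close>, the product \<open>t * w\<close> is a square root
    of \<open>- 1\<close>.\<close>
  interpret gaussian_curve ?p "(- m) mod ?p" c "t * w"
  proof
    show "prime ?p" by (rule assms(2))
    have "odd ?p" using t p by simp
    then show "?p \<noteq> 2" by auto
    have w': "?p dvd (t - 1) * w - 1" using w by (simp add: cong_iff_dvd_diff)
    have p': "?p dvd t\<^sup>2 + (t - 1)\<^sup>2" using p by simp
    have "q dvd (t * w)\<^sup>2 + 1" if "q dvd (t - 1) * w - 1" "q dvd t\<^sup>2 + (t - 1)\<^sup>2" for q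
      using that by Groebner_Basis.algebra
    from this[OF w' p'] show "?p dvd (t * w)\<^sup>2 + 1" .
    have m: "?p dvd m - c ^ 4" using c by (simp add: cong_iff_dvd_diff)
    show "\<not> ?p dvd c"
    proof
      assume "?p dvd c"
      then have "?p dvd (m - c ^ 4) + c ^ 4" using m by (intro dvd_add) (auto simp: dvd_power_le numeral_eq_Suc)
      with assms(3) show False by (simp add: cong_0_iff)
    qed
    have "?p dvd (- m) mod ?p - (- m)" by (simp only: mod_mod_trivial flip: mod_eq_dvd_iff)
    then have "?p dvd ((- m) mod ?p - (- m)) - (m - c ^ 4)" using m by (rule dvd_diff)
    then show "?p dvd (- m) mod ?p + c ^ 4" by simp
  qed
  define n where "n = int (order G)"
  obtain A B where AB: "A\<^sup>2 + B\<^sup>2 = ?p" "int (order G) = ?p + 1 + 2 * A"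
    by (rule order_sum_of_squares)
  then have n: "n = t\<^sup>2 + (t - 1)\<^sup>2 + 1 + 2 * A" by (simp only: n_def p)
  have "A\<^sup>2 = t\<^sup>2 \<or> A\<^sup>2 = (t - 1)\<^sup>2"
    by (rule prime_two_squares_unique[OF prime AB(1) p[symmetric]])
  then consider "A = t - 1" | "A = - (t - 1)" | "A = t" | "A = - t"
    by (auto simp: power2_eq_iff)
  moreover obtain z where z: "t = 2 * z" using t(1) by (elim evenE)
  moreover have eight: "8 dvd n" using eight_dvd_order unfolding n_def by presburger
  ultimately have "n = 2 * t\<^sup>2"
  proof cases
    case 1
    then show ?thesis using n by (simp add: power2_eq_square algebra_simps)
  next
    case 2
    then have "n = 8 * (z\<^sup>2 - z) + 4"
      using n z by (simp add: power2_eq_square algebra_simps)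
    with eight show ?thesis by presburger
  next
    case 3
    then have "n = 8 * z\<^sup>2 + 2"
      using n z by (simp add: power2_eq_square algebra_simps)
    with eight show ?thesis by presburger
  next
    case 4
    then have "n = 8 * (z\<^sup>2 - z) + 2"
      using n z by (simp add: power2_eq_square algebra_simps)
    with eight show ?thesis by presburger
  qed
  also have "\<dots> = int (2 ^ (2 * k + 1))" by (simp add: t_def power_even_eq)
  finally have "order G = 2 ^ (2 * k + 1)" by (simp only: n_def of_nat_eq_iff)
  then show ?thesis by (rule gaussian_group.iso_prod[OF gaussian_group_G])
qed

end
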